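(* Let $2<p<\infty$ and let $X$ be a (closed linear) subspace of $L_p=L_p[0,1]$ with an unconditional basis. Then there is an equivalent norm on $X$ given by partitions and weights (with exponent $p$).
   Context: Scalars are real and $L_p[0,1]$ is taken with respect to Lebesgue measure. Fix $2<p<\infty$. For a partition $P=\{N_i\}$ of $\mathbb{N}$ and a weight function $W=(w_j)_{j\in\mathbb{N}}:\mathbb{N}\to(0,1]$, define for a real sequence $(a_i)$ $$\|(a_i)\|_{P,W}=\left(\sum_i\left(\sum_{j\in N_i}a_j^2w_j^2\right)^{p/2}\right)^{1/p}.$$ For a nonempty family $\mathcal{P}=(P_k,W_k)_{k\in K}$ of pairs consisting of a partition $P_k$ of $\mathbb{N}$ and a weight function $W_k:\mathbb{N}\to(0,1]$, define $$\|(a_i)\|_{\mathcal{P}}=\sup_{k\in K}\|(a_i)\|_{P_k,W_k}.$$ This is called a norm determined (or given) by partitions and weights. To say that a Banach space $X$ has an equivalent norm given by partitions and weights (with exponent $p$) means that there are a Schauder basis $(x_n)$ of $X$, a nonempty family $\mathcal{P}=(P_k,W_k)_{k\in K}$ of pairs consisting of a partition $P_k$ of $\mathbb{N}$ and a weight function $W_k:\mathbb{N}\to(0,1]$, and constants $0<c\le C<\infty$ such that $$c\left\|\sum_n a_nx_n\right\|_X\le\|(a_n)\|_{\mathcal{P}}\le C\left\|\sum_n a_nx_n\right\|_X$$ for every $\sum_n a_nx_n\in X$; that is, $|||\sum_n a_nx_n|||=\|(a_n)\|_{\mathcal{P}}$ defines an equivalent norm on $X$. (If $X$ is finite-dimensional,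 the finite coefficient sequence is extended by zeros.) *)

theory Defs
  imports "HOL-Analysis.Analysis" "HOL-Library.Disjoint_Sets" "HOL-Library.Extended_Nat"
begin

text \<open>
  Elements of $L_p$ are handled through representatives: a set of functions, with the seminorm
  \<open>Lp_norm\<close>. A closed subspace, as defined below, is closed under limits in this
  seminorm; constant sequences show that it is then saturated under almost everywhere equality, so
  that such sets correspond one to one to the closed linear subspaces of the Banach space of
  equivalence classes.
\<close>

definition Lp_space :: "'s measure \<Rightarrow> real \<Rightarrow> ('s \<Rightarrow> real) set" where
  "Lp_space M p = {f. f \<in> borel_measurable M \<and> integrable M (\<lambda>t. \<bar>f t\<bar> powr p)}"

definition Lp_norm :: "'s measure \<Rightarrow> real \<Rightarrow> ('s \<Rightarrow> real) \<Rightarrow> real" where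
  "Lp_norm M p f = (\<integral>t. \<bar>f t\<bar> powr p \<partial>M) powr (1 / p)"

definition norm_tendsto ::
  "(('s \<Rightarrow> real) \<Rightarrow> real) \<Rightarrow> (nat \<Rightarrow> 's \<Rightarrow> real) \<Rightarrow> ('s \<Rightarrow> real) \<Rightarrow> bool" where
  "norm_tendsto nrm f g \<longleftrightarrow> (\<lambda>n. nrm (\<lambda>t. f n t - g t)) \<longlonglongrightarrow> 0"

definition closed_linear_subspace ::
  "(('s \<Rightarrow> real) \<Rightarrow> real) \<Rightarrow> ('s \<Rightarrow> real) set \<Rightarrow> ('s \<Rightarrow> real) set \<Rightarrow> bool" where
  "closed_linear_subspace nrm E X \<longleftrightarrow>
     X \<subseteq> E \<and> (\<lambda>t. 0) \<in> X \<and>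
     (\<forall>f\<in>X. \<forall>g\<in>X. (\<lambda>t. f t + g t) \<in> X) \<and>
     (\<forall>c. \<forall>f\<in>X. (\<lambda>t. c * f t) \<in> X) \<and>
     (\<forall>f g. (\<forall>n. f n \<in> X) \<and> g \<in> E \<and> norm_tendsto nrm f g \<longrightarrow> g \<in> X)"

definition series_to ::
  "(('s \<Rightarrow> real) \<Rightarrow> real) \<Rightarrow> (nat \<Rightarrow> 's \<Rightarrow> real) \<Rightarrow> (nat \<Rightarrow> real) \<Rightarrow> ('s \<Rightarrow> real) \<Rightarrow> bool" where
  "series_to nrm x a f \<longleftrightarrow> norm_tendsto nrm (\<lambda>n t. \<Sum>i<n. a i * x i t) f"

text \<open>
  The length \<open>d\<close> of a basis is its (finite or infinite) number of elements, so that
  finite-dimensional spaces are included. Coefficient sequences vanish at the indices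
  \<open>i \<ge> d\<close>; the values of \<open>x\<close> at these indices play no role.
\<close>

definition coeff_seq :: "enat \<Rightarrow> (nat \<Rightarrow> real) \<Rightarrow> bool" where
  "coeff_seq d a \<longleftrightarrow> (\<forall>i. d \<le> enat i \<longrightarrow> a i = 0)"

definition schauder_basis ::
  "(('s \<Rightarrow> real) \<Rightarrow> real) \<Rightarrow> ('s \<Rightarrow> real) set \<Rightarrow> enat \<Rightarrow> (nat \<Rightarrow> 's \<Rightarrow> real) \<Rightarrow> bool" where
  "schauder_basis nrm X d x \<longleftrightarrow>
     (\<forall>i. enat i < d \<longrightarrow> x i \<in> X) \<and>
     (\<forall>f\<in>X. \<exists>!a. coeff_seq d a \<and> series_to nrm x a f)"

definition unconditional_basis ::
  "(('s \<Rightarrow> real) \<Rightarrow> real) \<Rightarrow> ('s \<Rightarrow> real) set \<Rightarrow> enat \<Rightarrow> (nat \<Rightarrow> 's \<Rightarrow> real) \<Rightarrow> bool" where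
  "unconditional_basis nrm X d x \<longleftrightarrow>
     schauder_basis nrm X d x \<and>
     (\<forall>f\<in>X. \<forall>a. coeff_seq d a \<and> series_to nrm x a f \<longrightarrow>
        (\<forall>\<pi>. bij \<pi> \<longrightarrow> (\<exists>g\<in>X. series_to nrm (x \<circ> \<pi>) (a \<circ> \<pi>) g)))"

text \<open>The real power on \<open>[0, \<infinity>]\<close>, for positive exponents.\<close>

definition ennpowr :: "ennreal \<Rightarrow> real \<Rightarrow> ennreal" where
  "ennpowr u r = (if u = \<infinity> then \<infinity> else ennreal (enn2real u powr r))"

definition partition_weight_norm ::
  "real \<Rightarrow> nat set set \<Rightarrow> (nat \<Rightarrow> real) \<Rightarrow> (nat \<Rightarrow> real) \<Rightarrow> ennreal" where
  "partition_weight_norm p P W a =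
     ennpowr (\<Sum>\<^sub>\<infinity>N\<in>P. ennpowr (\<Sum>\<^sub>\<infinity>j\<in>N. ennreal ((a j)\<^sup>2 * (W j)\<^sup>2)) (p / 2)) (1 / p)"

definition partitions_weights_norm ::
  "real \<Rightarrow> (nat set set \<times> (nat \<Rightarrow> real)) set \<Rightarrow> (nat \<Rightarrow> real) \<Rightarrow> ennreal" where
  "partitions_weights_norm p F a = (SUP (P, W)\<in>F. partition_weight_norm p P W a)"

definition partitions_weights_family :: "(nat set set \<times> (nat \<Rightarrow> real)) set \<Rightarrow> bool" where
  "partitions_weights_family F \<longleftrightarrow>
     F \<noteq> {} \<and> (\<forall>(P, W)\<in>F. partition_on UNIV P \<and> (\<forall>j. 0 < W j \<and> W j \<le> 1))"

definition has_equivalent_partitions_weights_norm ::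
  "real \<Rightarrow> (('s \<Rightarrow> real) \<Rightarrow> real) \<Rightarrow> ('s \<Rightarrow> real) set \<Rightarrow> bool" where
  "has_equivalent_partitions_weights_norm p nrm X \<longleftrightarrow>
     (\<exists>d x F c C. schauder_basis nrm X d x \<and> partitions_weights_family F \<and> 0 < c \<and> c \<le> C \<and>
        (\<forall>f\<in>X. \<forall>a. coeff_seq d a \<and> series_to nrm x a f \<longrightarrow>
           ennreal (c * nrm f) \<le> partitions_weights_norm p F a \<and>
           partitions_weights_norm p F a \<le> ennreal (C * nrm f)))"

end

theory Submission
  imports Defs
begin

text \<open>Write \<open>q = p / 2 > 1\<close>. If \<open>x\<close> is an unconditional basis of \<open>X\<close>, then changing the signs of the
coefficients of \<open>f = \<Sum>\<^sub>i a\<^sub>i x\<^sub>i\<close> changes the norm by at most a constant factor. Averaging over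
all signs and applying Khintchine's inequality pointwise shows that \<open>\<parallel>f\<parallel>\<close> is equivalent to the
norm of the square function, that is, \<open>\<parallel>f\<parallel>\<^sup>2\<close> is equivalent to the norm of
\<open>\<Sum>\<^sub>i a\<^sub>i\<^sup>2 x\<^sub>i\<^sup>2\<close> in \<open>L\<^sub>q\<close>.

This function is non-negative, so by duality its norm is the supremum of
\<open>\<Sum>\<^sub>i a\<^sub>i\<^sup>2 \<integral> x\<^sub>i\<^sup>2 g\<close> over the non-negative \<open>g\<close> in the unit ball of the dual of \<open>L\<^sub>q\<close>. For
each \<open>g\<close> this is the square of the norm given by the partition with the single block \<open>\<nat>\<close> and the
weights \<open>w\<^sub>i\<close> with \<open>w\<^sub>i\<^sup>2 = \<integral> x\<^sub>i\<^sup>2 g\<close>. If the basis is normalized, then \<open>w\<^sub>i \<le> 1\<close>, and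
\<open>w\<^sub>i > 0\<close> as soon as \<open>g\<close> is strictly positive. So the family of all these weights, each with the
trivial partition, determines an equivalent norm. Here \<open>g\<close> is taken of the form
\<open>(h powr (q - 1) + 1) / 4\<close> with \<open>h\<close> in the non-negative unit ball of \<open>L\<^sub>q\<close>; for such \<open>g\<close> the
required form of Hoelder's inequality is elementary (\<open>dual_test_function_bound\<close>). The two estimates
are \<open>weighted_sum_le\<close> and \<open>weighted_sum_ge\<close>.

Unconditionality is given as convergence of all rearrangements of each expansion. That it implies a
uniform bound for the projections onto finite sets of coordinates (\<open>projections_uniformly_bounded\<close>)
is proved in two steps: the finite sums of a single expansion are bounded
(\<open>rearrangements_convergent_imp_finite_sums_bounded\<close>), and the supremum of their norms is a countably
subadditive seminorm in \<open>f\<close>, hence bounded by a multiple of the norm on the complete space \<open>X\<close>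
(\<open>countably_subadditive_seminorm_bounded\<close>).\<close>

section \<open>The spaces \<open>L\<^sub>p\<close>\<close>

text \<open>Convexity of \<open>u \<mapsto> u powr p\<close> on the closed half-line. At the endpoint \<open>0\<close> the inequality
reduces to \<open>c powr p \<le> c\<close> for \<open>0 < c \<le> 1\<close>.\<close>
lemma powr_combination_le:
  fixes u v :: real
  assumes "1 \<le> p" "0 \<le> u" "0 \<le> v" "0 < \<alpha>" "0 < \<beta>" "\<alpha> + \<beta> = 1"
  shows "(\<alpha> * u + \<beta> * v) powr p \<le> \<alpha> * u powr p + \<beta> * v powr p"
proof -
  have scale: "(c * w) powr p \<le> c * w powr p" if "0 < c" "c \<le> 1" "0 \<le> w" for c w :: real
  proof -
    have "c powr p \<le> c powr 1" using that assms by (intro powr_mono') auto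
    then show ?thesis using that by (simp add: powr_mult mult_right_mono)
  qed
  consider "u = 0" | "v = 0" | "0 < u" "0 < v" using assms by linarith
  then show ?thesis
  proof cases
    case 1
    then show ?thesis using scale[of \<beta> v] assms by simp
  next
    case 2
    then show ?thesis using scale[of \<alpha> u] assms by simp
  next
    case 3
    then show ?thesis
      using convex_onD[OF powr_convex[OF assms(1)], of \<beta> u v] assms
      by (simp add: eq_diff_eq[symmetric])
  qed
qed

lemma Lp_norm_nonneg: "0 \<le> Lp_norm M p f"
  by (simp add: Lp_norm_def)

lemma Lp_norm_powr:
  assumes "0 < p"
  shows "Lp_norm M p f powr p = (\<integral>t. \<bar>f t\<bar> powr p \<partial>M)"
  using assms by (simp add: Lp_norm_def powr_powr)

lemma Lp_norm_le_iff:
  assumes "0 < p" "0 \<le> c"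
  shows "Lp_norm M p f \<le> c \<longleftrightarrow> (\<integral>t. \<bar>f t\<bar> powr p \<partial>M) \<le> c powr p"
proof
  assume "Lp_norm M p f \<le> c"
  then have "Lp_norm M p f powr p \<le> c powr p"
    using assms by (intro powr_mono2 Lp_norm_nonneg) auto
  then show "(\<integral>t. \<bar>f t\<bar> powr p \<partial>M) \<le> c powr p" using assms by (simp add: Lp_norm_powr)
next
  assume "(\<integral>t. \<bar>f t\<bar> powr p \<partial>M) \<le> c powr p"
  then have "Lp_norm M p f \<le> (c powr p) powr (1 / p)"
    unfolding Lp_norm_def using assms by (intro powr_mono2) auto
  then show "Lp_norm M p f \<le> c" using assms by (simp add: powr_powr)
qed

lemma Lp_norm_scale: "0 < p \<Longrightarrow> Lp_norm M p (\<lambda>t. c * f t) = \<bar>c\<bar> * Lp_norm M p f"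
  by (simp add: Lp_norm_def abs_mult powr_mult powr_powr)

lemma Lp_space_measurable: "f \<in> Lp_space M p \<Longrightarrow> f \<in> borel_measurable M"
  by (simp add: Lp_space_def)

lemma Lp_space_integrable: "f \<in> Lp_space M p \<Longrightarrow> integrable M (\<lambda>t. \<bar>f t\<bar> powr p)"
  by (simp add: Lp_space_def)

lemma Lp_space_bounded_by:
  assumes "f \<in> borel_measurable M" "integrable M G" "AE t in M. \<bar>f t\<bar> powr p \<le> G t"
  shows "f \<in> Lp_space M p"
  unfolding Lp_space_def
proof (intro CollectI conjI assms(1))
  show "integrable M (\<lambda>t. \<bar>f t\<bar> powr p)"
    by (rule Bochner_Integration.integrable_bound[OF assms(2)])
      (use assms in \<open>auto elim!: eventually_mono\<close>)
qed

lemma Lp_space_scale: "f \<in> Lp_space M p \<Longrightarrow> (\<lambda>t. c * f t) \<in> Lp_space M p"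
  by (auto simp: Lp_space_def abs_mult powr_mult)

text \<open>Minkowski's inequality in the form that convexity gives directly: if \<open>\<alpha>\<close> and \<open>\<beta>\<close> bound the
two norms, then \<open>\<bar>f + g\<bar> / (\<alpha> + \<beta>)\<close> is at most the convex combination of \<open>\<bar>f\<bar> / \<alpha>\<close> and
\<open>\<bar>g\<bar> / \<beta>\<close> with coefficients \<open>\<alpha> / (\<alpha> + \<beta>)\<close> and \<open>\<beta> / (\<alpha> + \<beta>)\<close>. Strictly positive bounds
avoid a separate treatment of functions that vanish almost everywhere.\<close>
lemma Minkowski_at:
  assumes p: "1 \<le> p" and f: "f \<in> Lp_space M p" and g: "g \<in> Lp_space M p"
    and \<alpha>: "Lp_norm M p f \<le> \<alpha>" "0 < \<alpha>" and \<beta>: "Lp_norm M p g \<le> \<beta>" "0 < \<beta>"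
  shows "(\<lambda>t. f t + g t) \<in> Lp_space M p" "Lp_norm M p (\<lambda>t. f t + g t) \<le> \<alpha> + \<beta>"
proof -
  define s where "s = \<alpha> + \<beta>"
  have s: "0 < s" using \<alpha> \<beta> by (simp add: s_def)
  define G where "G t = s powr p * (\<alpha> / s * (\<bar>f t\<bar> powr p / \<alpha> powr p) + \<beta> / s * (\<bar>g t\<bar> powr p / \<beta> powr p))" for t
  have pointwise: "\<bar>f t + g t\<bar> powr p \<le> G t" for t
  proof -
    have "\<bar>f t + g t\<bar> \<le> s * (\<alpha> / s * (\<bar>f t\<bar> / \<alpha>) + \<beta> / s * (\<bar>g t\<bar> / \<beta>))"
      using \<alpha>(2) \<beta>(2) s abs_triangle_ineq[of "f t" "g t"] by (simp add: distrib_left)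
    then have "\<bar>f t + g t\<bar> powr p \<le> (s * (\<alpha> / s * (\<bar>f t\<bar> / \<alpha>) + \<beta> / s * (\<bar>g t\<bar> / \<beta>))) powr p"
      using p by (intro powr_mono2) auto
    also have "\<dots> = s powr p * (\<alpha> / s * (\<bar>f t\<bar> / \<alpha>) + \<beta> / s * (\<bar>g t\<bar> / \<beta>)) powr p"
      using s \<alpha> \<beta> by (simp add: powr_mult)
    also have "\<dots> \<le> s powr p * (\<alpha> / s * (\<bar>f t\<bar> / \<alpha>) powr p + \<beta> / s * (\<bar>g t\<bar> / \<beta>) powr p)"
      using p \<alpha> \<beta> s
      by (intro mult_left_mono powr_combination_le) (auto simp: s_def add_divide_distrib[symmetric])
    also have "\<dots> = G t" using \<alpha> \<beta> by (simp add: G_def powr_divide)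
    finally show ?thesis .
  qed
  have intG: "integrable M G"
    unfolding G_def
    by (intro integrable_mult_right Bochner_Integration.integrable_add integrable_divide
        Lp_space_integrable f g)
  show mem: "(\<lambda>t. f t + g t) \<in> Lp_space M p"
    using f g pointwise
    by (intro Lp_space_bounded_by[OF _ intG]) (auto intro: Lp_space_measurable borel_measurable_add)
  have "(\<integral>t. \<bar>f t + g t\<bar> powr p \<partial>M) \<le> (\<integral>t. G t \<partial>M)"
    using intG mem pointwise by (intro integral_mono) (auto intro: Lp_space_integrable)
  also have "\<dots> = s powr p * (\<alpha> / s * ((\<integral>t. \<bar>f t\<bar> powr p \<partial>M) / \<alpha> powr p)
      + \<beta> / s * ((\<integral>t. \<bar>g t\<bar> powr p \<partial>M) / \<beta> powr p))"
    unfolding G_def using f g by (simp add: Lp_space_integrable)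
  also have "\<dots> \<le> s powr p * (\<alpha> / s * 1 + \<beta> / s * 1)"
  proof (intro mult_left_mono add_mono)
    show "(\<integral>t. \<bar>f t\<bar> powr p \<partial>M) / \<alpha> powr p \<le> 1" "(\<integral>t. \<bar>g t\<bar> powr p \<partial>M) / \<beta> powr p \<le> 1"
      using \<alpha> \<beta> p by (simp_all add: Lp_norm_le_iff)
  qed (use \<alpha> \<beta> s in auto)
  also have "\<dots> = s powr p" using s by (simp add: s_def add_divide_distrib[symmetric])
  finally show "Lp_norm M p (\<lambda>t. f t + g t) \<le> \<alpha> + \<beta>"
    using p s by (subst Lp_norm_le_iff) (auto simp: s_def)
qed

lemma Lp_space_add:
  assumes "1 \<le> p" "f \<in> Lp_space M p" "g \<in> Lp_space M p"
  shows "(\<lambda>t. f t + g t) \<in> Lp_space M p"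
  by (rule Minkowski_at(1)[OF assms, of "Lp_norm M p f + 1" "Lp_norm M p g + 1"])
    (use Lp_norm_nonneg[of M p] in \<open>auto intro: add_nonneg_pos\<close>)

lemma Minkowski:
  assumes "1 \<le> p" "f \<in> Lp_space M p" "g \<in> Lp_space M p"
  shows "Lp_norm M p (\<lambda>t. f t + g t) \<le> Lp_norm M p f + Lp_norm M p g"
proof (rule field_le_epsilon)
  fix e :: real assume "0 < e"
  then have "Lp_norm M p (\<lambda>t. f t + g t) \<le> (Lp_norm M p f + e / 2) + (Lp_norm M p g + e / 2)"
    using Lp_norm_nonneg[of M p] by (intro Minkowski_at(2)[OF assms]) (auto intro: add_nonneg_pos)
  then show "Lp_norm M p (\<lambda>t. f t + g t) \<le> Lp_norm M p f + Lp_norm M p g + e" by simp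
qed

lemma Lp_space_sum_Minkowski:
  assumes "1 \<le> p" "\<And>i. i \<in> F \<Longrightarrow> u i \<in> Lp_space M p"
  shows "(\<lambda>t. \<Sum>i\<in>F. u i t) \<in> Lp_space M p \<and>
    Lp_norm M p (\<lambda>t. \<Sum>i\<in>F. u i t) \<le> (\<Sum>i\<in>F. Lp_norm M p (u i))"
  using assms(2)
proof (induction F rule: infinite_finite_induct)
  case (insert x F)
  then show ?case
    using Minkowski[OF assms(1), of "u x" M "\<lambda>t. \<Sum>i\<in>F. u i t"]
      Lp_space_add[OF assms(1), of "u x" M "\<lambda>t. \<Sum>i\<in>F. u i t"] by fastforce
qed (use assms(1) in \<open>auto simp: Lp_space_def Lp_norm_def\<close>)

text \<open>The Riesz--Fischer argument. The sums of the \<open>\<bar>u k\<bar>\<close> increase and stay bounded in norm, so by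
monotone convergence the limit \<open>H\<close> of their \<open>p\<close>-th powers is integrable and the series converges
absolutely almost everywhere. The \<open>p\<close>-th powers of its tails are dominated by \<open>H\<close>.\<close>
lemma Lp_complete:
  assumes p: "1 \<le> p" and u: "\<And>n. u n \<in> Lp_space M p"
    and sum: "summable (\<lambda>n. Lp_norm M p (u n))"
  shows "\<exists>g\<in>Lp_space M p. norm_tendsto (Lp_norm M p) (\<lambda>n t. \<Sum>k<n. u k t) g"
proof -
  define S where "S n t = (\<Sum>k<n. \<bar>u k t\<bar>)" for n t
  define L where "L = (\<Sum>n. Lp_norm M p (u n))"
  have [measurable]: "u n \<in> borel_measurable M" for n by (rule Lp_space_measurable[OF u])
  have abs_mem: "(\<lambda>t. \<bar>u n t\<bar>) \<in> Lp_space M p" for n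
    using u[of n] by (auto simp: Lp_space_def)
  have S_mem: "S n \<in> Lp_space M p" and S_norm: "Lp_norm M p (S n) \<le> L" for n
  proof -
    have *: "(\<lambda>t. \<Sum>k<n. \<bar>u k t\<bar>) \<in> Lp_space M p \<and>
        Lp_norm M p (\<lambda>t. \<Sum>k<n. \<bar>u k t\<bar>) \<le> (\<Sum>k<n. Lp_norm M p (\<lambda>t. \<bar>u k t\<bar>))"
      by (rule Lp_space_sum_Minkowski) (use p abs_mem in auto)
    have "(\<Sum>k<n. Lp_norm M p (\<lambda>t. \<bar>u k t\<bar>)) = (\<Sum>k<n. Lp_norm M p (u k))"
      by (simp add: Lp_norm_def)
    also have "\<dots> \<le> L" unfolding L_def
      by (rule sum_le_suminf[OF sum]) (auto simp: Lp_norm_nonneg)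
    finally have "Lp_norm M p (\<lambda>t. \<Sum>k<n. \<bar>u k t\<bar>) \<le> L" using * by linarith
    then show "S n \<in> Lp_space M p" "Lp_norm M p (S n) \<le> L"
      using * by (simp_all add: S_def[abs_def])
  qed
  have L0: "0 \<le> L" using S_norm[of 0] Lp_norm_nonneg order_trans by blast
  have S_nonneg: "0 \<le> S n t" for n t by (simp add: S_def sum_nonneg)
  have S_mono: "S n t \<le> S m t" if "n \<le> m" for n m t
    unfolding S_def using that by (intro sum_mono2) auto
  have int_bound: "(\<integral>\<^sup>+t. ennreal (S n t powr p) \<partial>M) \<le> ennreal (L powr p)" for n
  proof -
    have "(\<integral>\<^sup>+t. ennreal (S n t powr p) \<partial>M) = ennreal (\<integral>t. S n t powr p \<partial>M)"
      using Lp_space_integrable[OF S_mem[of n]] S_nonneg by (intro nn_integral_eq_integral) auto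
    also have "\<dots> \<le> ennreal (L powr p)"
      using S_norm[of n] p L0 S_nonneg by (simp add: Lp_norm_le_iff ennreal_leI)
    finally show ?thesis .
  qed
  define G where "G t = (SUP n. ennreal (S n t powr p))" for t
  have [measurable]: "S n \<in> borel_measurable M" for n unfolding S_def by measurable
  have [measurable]: "G \<in> borel_measurable M" unfolding G_def by measurable
  have "(\<integral>\<^sup>+t. G t \<partial>M) = (SUP n. \<integral>\<^sup>+t. ennreal (S n t powr p) \<partial>M)"
    unfolding G_def
    by (rule nn_integral_monotone_convergence_SUP)
      (use p S_nonneg S_mono in \<open>auto simp: incseq_def le_fun_def intro!: ennreal_leI powr_mono2\<close>)
  also have "\<dots> \<le> ennreal (L powr p)" using int_bound by (intro SUP_least) auto
  finally have finG: "(\<integral>\<^sup>+t. G t \<partial>M) < \<infinity>" by (simp add: le_less_trans)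
  then have AE_G: "AE t in M. G t < \<infinity>"
    using nn_integral_PInf_AE[of G M] by (auto simp: less_top)
  define H where "H t = enn2real (G t)" for t
  have intH: "integrable M H"
  proof (rule integrableI_nonneg)
    have "(\<integral>\<^sup>+t. ennreal (H t) \<partial>M) = (\<integral>\<^sup>+t. G t \<partial>M)"
      by (rule nn_integral_cong_AE) (use AE_G in \<open>eventually_elim, auto simp: H_def\<close>)
    then show "(\<integral>\<^sup>+t. ennreal (H t) \<partial>M) < \<infinity>" using finG by simp
    show "H \<in> borel_measurable M" unfolding H_def[abs_def] by measurable
  qed (simp add: H_def)
  define g where "g t = lim (\<lambda>n. \<Sum>k<n. u k t)" for t
  have [measurable]: "g \<in> borel_measurable M" unfolding g_def by measurable
  have AE_sum: "AE t in M. (\<forall>n. S n t powr p \<le> H t) \<and> summable (\<lambda>k. \<bar>u k t\<bar>)"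
    using AE_G
  proof eventually_elim
    case (elim t)
    have le: "S n t powr p \<le> H t" for n
    proof -
      have "ennreal (S n t powr p) \<le> G t" unfolding G_def by (rule SUP_upper) simp
      then show ?thesis unfolding H_def using elim
        by (metis enn2real_ennreal enn2real_mono powr_ge_zero infinity_ennreal_def)
    qed
    have "S n t \<le> H t powr (1 / p)" for n
      using powr_mono2[OF _ _ le[of n], of "1/p"] p S_nonneg by (simp add: powr_powr)
    then have "summable (\<lambda>k. \<bar>u k t\<bar>)"
      by (intro summableI_nonneg_bounded[where x = "H t powr (1/p)"]) (auto simp: S_def)
    with le show ?case by blast
  qed
  have tail: "AE t in M. (\<forall>n. \<bar>(\<Sum>k<n. u k t) - g t\<bar> powr p \<le> H t) \<and>
      (\<lambda>n. \<bar>(\<Sum>k<n. u k t) - g t\<bar> powr p) \<longlonglongrightarrow> 0"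
    using AE_sum
  proof eventually_elim
    case (elim t)
    then have s: "summable (\<lambda>k. u k t)" and abs_s: "summable (\<lambda>k. \<bar>u k t\<bar>)"
      by (auto intro: summable_rabs_cancel)
    then have lim: "(\<lambda>n. \<Sum>k<n. u k t) \<longlonglongrightarrow> g t"
      unfolding g_def using summable_iff_convergent convergent_LIMSEQ_iff by blast
    have "\<bar>(\<Sum>k<n. u k t) - g t\<bar> powr p \<le> H t" for n
    proof (rule LIMSEQ_le_const2)
      show "(\<lambda>m. \<bar>(\<Sum>k<n. u k t) - (\<Sum>k<m. u k t)\<bar> powr p) \<longlonglongrightarrow>
          \<bar>(\<Sum>k<n. u k t) - g t\<bar> powr p"
        using p by (intro tendsto_powr' tendsto_intros lim) auto
      show "\<exists>N. \<forall>m\<ge>N. \<bar>(\<Sum>k<n. u k t) - (\<Sum>k<m. u k t)\<bar> powr p \<le> H t"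
      proof (intro exI[of _ n] allI impI)
        fix m assume "n \<le> m"
        then have "(\<Sum>k<m. u k t) - (\<Sum>k<n. u k t) = (\<Sum>k=n..<m. u k t)"
          by (metis atLeast0LessThan sum_diff_nat_ivl zero_le)
        then have "\<bar>(\<Sum>k<n. u k t) - (\<Sum>k<m. u k t)\<bar> \<le> (\<Sum>k=n..<m. \<bar>u k t\<bar>)"
          by (metis abs_minus_commute sum_abs)
        also have "\<dots> \<le> S m t" unfolding S_def by (intro sum_mono2) auto
        finally have "\<bar>(\<Sum>k<n. u k t) - (\<Sum>k<m. u k t)\<bar> powr p \<le> S m t powr p"
          using p by (intro powr_mono2) auto
        then show "\<bar>(\<Sum>k<n. u k t) - (\<Sum>k<m. u k t)\<bar> powr p \<le> H t"
          using elim by (meson order_trans)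
      qed
    qed
    moreover have "(\<lambda>n. \<bar>(\<Sum>k<n. u k t) - g t\<bar> powr p) \<longlonglongrightarrow> \<bar>g t - g t\<bar> powr p"
      using p by (intro tendsto_powr' tendsto_intros lim) auto
    ultimately show ?case using p by simp
  qed
  have gLp: "g \<in> Lp_space M p"
  proof (rule Lp_space_bounded_by[OF _ intH])
    show "AE t in M. \<bar>g t\<bar> powr p \<le> H t"
      using tail by eventually_elim (metis abs_minus_commute diff_zero lessThan_0 sum.empty)
  qed simp
  have "(\<lambda>n. \<integral>t. \<bar>(\<Sum>k<n. u k t) - g t\<bar> powr p \<partial>M) \<longlonglongrightarrow> (\<integral>t. 0 \<partial>M)"
  proof (rule integral_dominated_convergence[OF _ _ intH])
    show "AE t in M. (\<lambda>n. \<bar>(\<Sum>k<n. u k t) - g t\<bar> powr p) \<longlonglongrightarrow> 0"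
      using tail by eventually_elim simp
    show "AE t in M. norm (\<bar>(\<Sum>k<n. u k t) - g t\<bar> powr p) \<le> H t" for n
      using tail by eventually_elim simp
  qed measurable
  then have "(\<lambda>n. Lp_norm M p (\<lambda>t. (\<Sum>k<n. u k t) - g t)) \<longlonglongrightarrow> 0 powr (1 / p)"
    unfolding Lp_norm_def using p by (intro tendsto_powr') (auto simp: integral_nonneg_AE)
  then show ?thesis using gLp p unfolding norm_tendsto_def by auto
qed

section \<open>Countably subadditive seminorms on complete spaces\<close>

text \<open>Elements of \<open>X\<close> are functions, not equivalence classes, so \<open>nrm\<close> may vanish at non-zero elements.
Completeness is expressed by absolutely convergent series.\<close>
locale complete_seminormed_space =
  fixes nrm :: "('s \<Rightarrow> real) \<Rightarrow> real" and X :: "('s \<Rightarrow> real) set"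
  assumes zero_mem: "(\<lambda>t. 0) \<in> X"
    and add_mem: "f \<in> X \<Longrightarrow> g \<in> X \<Longrightarrow> (\<lambda>t. f t + g t) \<in> X"
    and scale_mem: "f \<in> X \<Longrightarrow> (\<lambda>t. c * f t) \<in> X"
    and nrm_nonneg: "0 \<le> nrm f"
    and nrm_triangle: "f \<in> X \<Longrightarrow> g \<in> X \<Longrightarrow> nrm (\<lambda>t. f t + g t) \<le> nrm f + nrm g"
    and nrm_scale: "f \<in> X \<Longrightarrow> nrm (\<lambda>t. c * f t) = \<bar>c\<bar> * nrm f"
    and complete: "(\<And>n. u n \<in> X) \<Longrightarrow> summable (\<lambda>n. nrm (u n)) \<Longrightarrow>
      \<exists>g\<in>X. norm_tendsto nrm (\<lambda>n t. \<Sum>k<n. u k t) g"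
begin

lemma diff_mem: "f \<in> X \<Longrightarrow> g \<in> X \<Longrightarrow> (\<lambda>t. f t - g t) \<in> X"
  using add_mem[of f "\<lambda>t. (-1) * g t"] scale_mem[of g "-1"] by simp

lemma nrm_zero: "nrm (\<lambda>t. 0) = 0"
  using nrm_scale[OF zero_mem, of 0] by simp

lemma nrm_minus_commute: "f \<in> X \<Longrightarrow> g \<in> X \<Longrightarrow> nrm (\<lambda>t. f t - g t) = nrm (\<lambda>t. g t - f t)"
  using nrm_scale[OF diff_mem, of g f "-1"] by simp

lemma nrm_triangle_diff: "f \<in> X \<Longrightarrow> g \<in> X \<Longrightarrow> nrm (\<lambda>t. f t - g t) \<le> nrm f + nrm g"
  using nrm_triangle[of f "\<lambda>t. (-1) * g t"] scale_mem[of g "-1"] nrm_scale[of g "-1"] by simp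

lemma nrm_triangle_via:
  "f \<in> X \<Longrightarrow> g \<in> X \<Longrightarrow> h \<in> X \<Longrightarrow>
    nrm (\<lambda>t. f t - h t) \<le> nrm (\<lambda>t. f t - g t) + nrm (\<lambda>t. g t - h t)"
  using nrm_triangle[of "\<lambda>t. f t - g t" "\<lambda>t. g t - h t"] by (simp add: diff_mem)

lemma nrm_le_diff_add: "f \<in> X \<Longrightarrow> g \<in> X \<Longrightarrow> nrm f \<le> nrm (\<lambda>t. f t - g t) + nrm g"
  using nrm_triangle[of "\<lambda>t. f t - g t" g] by (simp add: diff_mem)

lemma sum_mem: "(\<And>i. i \<in> F \<Longrightarrow> u i \<in> X) \<Longrightarrow> (\<lambda>t. \<Sum>i\<in>F. u i t) \<in> X"
proof (induction F rule: infinite_finite_induct)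
  case (insert x F)
  then show ?case using add_mem[of "u x" "\<lambda>t. \<Sum>i\<in>F. u i t"] by simp
qed (auto simp: zero_mem)

lemma nrm_sum_le: "(\<And>i. i \<in> F \<Longrightarrow> u i \<in> X) \<Longrightarrow> nrm (\<lambda>t. \<Sum>i\<in>F. u i t) \<le> (\<Sum>i\<in>F. nrm (u i))"
proof (induction F rule: infinite_finite_induct)
  case (insert x F)
  then show ?case
    using nrm_triangle[of "u x" "\<lambda>t. \<Sum>i\<in>F. u i t"] by (fastforce simp: sum_mem)
qed (auto simp: nrm_zero)

text \<open>Zabreiko's lemma. The sets where \<open>q \<le> n\<close> cover \<open>X\<close>, so by a Baire category argument the closure
of one of them contains a ball. These sets are convex and symmetric; hence, up to scaling, every
small \<open>h\<close> can be approximated by elements on which \<open>q\<close> is controlled. Iterating the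
approximation writes \<open>h\<close> as a series whose \<open>q\<close>-values form a geometric series, and countable
subadditivity bounds \<open>q h\<close>.\<close>
lemma countably_subadditive_seminorm_bounded:
  fixes q :: "('s \<Rightarrow> real) \<Rightarrow> real"
  assumes q_nonneg: "\<And>f. f \<in> X \<Longrightarrow> 0 \<le> q f"
    and q_scale: "\<And>c f. f \<in> X \<Longrightarrow> q (\<lambda>t. c * f t) = \<bar>c\<bar> * q f"
    and q_triangle: "\<And>f g. f \<in> X \<Longrightarrow> g \<in> X \<Longrightarrow> q (\<lambda>t. f t + g t) \<le> q f + q g"
    and q_series: "\<And>u f. (\<And>n. u n \<in> X) \<Longrightarrow> f \<in> X \<Longrightarrow> summable (\<lambda>n. q (u n)) \<Longrightarrow>
      norm_tendsto nrm (\<lambda>n t. \<Sum>k<n. u k t) f \<Longrightarrow> q f \<le> (\<Sum>n. q (u n))"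
  shows "\<exists>K\<ge>0. \<forall>f\<in>X. q f \<le> K * nrm f"
proof -
  have q_diff: "q (\<lambda>t. f t - g t) \<le> q f + q g" if "f \<in> X" "g \<in> X" for f g
    using q_triangle[of f "\<lambda>t. (-1) * g t"] scale_mem[of g "-1"] q_scale[of g "-1"] that by simp
  have "\<exists>n::nat. \<exists>f0\<in>X. \<exists>r>0. \<forall>f\<in>X. nrm (\<lambda>t. f t - f0 t) < r \<longrightarrow>
      (\<forall>\<epsilon>>0. \<exists>g\<in>X. q g \<le> real n \<and> nrm (\<lambda>t. f t - g t) < \<epsilon>)"
  proof (rule ccontr)
    assume contra: "\<not> ?thesis"
    \<comment> \<open>If no such ball exists, nested balls can be chosen so that the \<open>(n+1)\<close>-st one avoids all \<open>g\<close>
      with \<open>q g \<le> n\<close>; a common point of all of them would have \<open>q\<close>-value above every \<open>n\<close>.\<close>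
    have step: "\<exists>f'. f' \<in> X \<and> nrm (\<lambda>t. f' t - f t) < r \<and> 
        (\<exists>\<epsilon>>0. \<forall>g\<in>X. q g \<le> real n \<longrightarrow> \<epsilon> \<le> nrm (\<lambda>t. f' t - g t))" if "f \<in> X" "0 < r" for f n r
      using contra that by (metis not_less)
    let ?P = "\<lambda>n z. fst z \<in> X \<and> snd z > (0::real)"
    let ?Q = "\<lambda>n z z'. nrm (\<lambda>t. fst z' t - fst z t) < snd z / 2 \<and> snd z' \<le> snd z / 2 \<and>
        (\<forall>g\<in>X. q g \<le> real n \<longrightarrow> snd z' < nrm (\<lambda>t. fst z' t - g t))"
    have "\<exists>z. \<forall>n. ?P n (z n) \<and> ?Q n (z n) (z (Suc n))"
    proof (rule dependent_nat_choice)
      show "\<exists>z. ?P 0 z" using zero_mem by (intro exI[of _ "(\<lambda>t. 0, 1)"]) simp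
    next
      fix z :: "('s \<Rightarrow> real) \<times> real" and n :: nat
      assume z: "?P n z"
      then obtain f' \<epsilon> where f': "f' \<in> X" "nrm (\<lambda>t. f' t - fst z t) < snd z / 2" "\<epsilon> > 0"
        "\<forall>g\<in>X. q g \<le> real n \<longrightarrow> \<epsilon> \<le> nrm (\<lambda>t. f' t - g t)"
        using step[of "fst z" "snd z / 2" n] by auto
      have lt: "min (\<epsilon> / 2) (snd z / 2) < \<epsilon>" using f' by auto
      show "\<exists>z'. ?P (Suc n) z' \<and> ?Q n z z'"
        using f' z lt by (intro exI[of _ "(f', min (\<epsilon>/2) (snd z / 2))"]) (auto intro: less_le_trans)
    qed
    then obtain z where z: "\<And>n. ?P n (z n)" "\<And>n. ?Q n (z n) (z (Suc n))" by blast
    define f where "f n = fst (z n)" for n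
    define r where "r n = snd (z n)" for n
    have f: "f n \<in> X" and r: "r n > 0" "r (Suc n) \<le> r n / 2"
      and close: "nrm (\<lambda>t. f (Suc n) t - f n t) < r n / 2"
      and far: "\<And>g. g \<in> X \<Longrightarrow> q g \<le> real n \<Longrightarrow> r (Suc n) < nrm (\<lambda>t. f (Suc n) t - g t)" for n
      using z[of n] by (auto simp: f_def r_def)
    have rdecay: "r (m + k) \<le> r m / 2 ^ k" for m k
    proof (induction k)
      case (Suc k)
      have "r (m + Suc k) \<le> r (m + k) / 2" using r(2)[of "m + k"] by simp
      also have "\<dots> \<le> r m / 2 ^ k / 2" using Suc by simp
      finally show ?case by simp
    qed simp
    define u where "u n = (\<lambda>t. f (Suc n) t - f n t)" for n
    have u: "u n \<in> X" for n unfolding u_def by (intro diff_mem f)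
    have "summable (\<lambda>n. nrm (u n))"
    proof (rule summable_comparison_test)
      show "summable (\<lambda>n. r 0 * (1/2) ^ n)" by (intro summable_mult summable_geometric) simp
      show "\<exists>N. \<forall>n\<ge>N. norm (nrm (u n)) \<le> r 0 * (1/2) ^ n"
      proof (intro exI[of _ 0] allI impI)
        fix n
        show "norm (nrm (u n)) \<le> r 0 * (1/2) ^ n"
          using close[of n] rdecay[of 0 n] nrm_nonneg[of "u n"] r(1)[of n]
          by (simp add: u_def power_one_over)
      qed
    qed
    from complete[OF u this] obtain g0 where g0: "g0 \<in> X"
      "norm_tendsto nrm (\<lambda>n t. \<Sum>k<n. u k t) g0" by blast
    define g where "g = (\<lambda>t. g0 t + f 0 t)"
    have gX: "g \<in> X" unfolding g_def by (intro add_mem g0 f)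
    have "(\<Sum>k<n. u k t) - g0 t = f n t - g t" for n t
      using sum_lessThan_telescope[of "\<lambda>k. f k t" n] by (simp add: u_def g_def)
    then have lim: "(\<lambda>n. nrm (\<lambda>t. f n t - g t)) \<longlonglongrightarrow> 0"
      using g0(2) unfolding norm_tendsto_def by simp
    have walk: "nrm (\<lambda>t. f m t - f (m + k) t) \<le> r m * (1 - 1 / 2 ^ k)" for m k
    proof (induction k)
      case 0 then show ?case by (simp add: nrm_zero)
    next
      case (Suc k)
      have "nrm (\<lambda>t. f m t - f (m + Suc k) t)
          \<le> nrm (\<lambda>t. f m t - f (m + k) t) + nrm (\<lambda>t. f (m + k) t - f (Suc (m + k)) t)"
        using nrm_triangle_via[OF f f f] by simp
      also have "\<dots> \<le> r m * (1 - 1 / 2 ^ k) + r m / 2 ^ k / 2"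
      proof (rule add_mono[OF Suc])
        have "nrm (\<lambda>t. f (m + k) t - f (Suc (m + k)) t) \<le> r (m + k) / 2"
          using close[of "m+k"] nrm_minus_commute[OF f f, of "m+k" "Suc (m+k)"] by linarith
        also have "\<dots> \<le> r m / 2 ^ k / 2" using rdecay[of m k] by simp
        finally show "nrm (\<lambda>t. f (m + k) t - f (Suc (m + k)) t) \<le> r m / 2 ^ k / 2" .
      qed
      finally show ?case by (simp add: field_simps)
    qed
    have near: "nrm (\<lambda>t. f m t - g t) \<le> r m" for m
    proof (rule LIMSEQ_le_const)
      show "(\<lambda>k. r m + nrm (\<lambda>t. f (k + m) t - g t)) \<longlonglongrightarrow> r m"
        using tendsto_add[OF tendsto_const LIMSEQ_ignore_initial_segment[OF lim, of m], of "r m"] by simp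
      have "nrm (\<lambda>t. f m t - g t) \<le> r m + nrm (\<lambda>t. f (k + m) t - g t)" for k
      proof -
        have "r m * (1 - 1 / 2 ^ k) \<le> r m * 1" using r(1)[of m] by (intro mult_left_mono) auto
        then show ?thesis
          using nrm_triangle_via[OF f f gX, of m "m+k"] walk[of m k] by (simp add: add.commute)
      qed
      then show "\<exists>N. \<forall>k\<ge>N. nrm (\<lambda>t. f m t - g t) \<le> r m + nrm (\<lambda>t. f (k + m) t - g t)" by blast
    qed
    obtain n :: nat where "q g \<le> real n" using real_arch_simple by blast
    from far[OF gX this] near[of "Suc n"] show False by simp
  qed
  then obtain n :: nat and f0 r where f0: "f0 \<in> X" and r: "r > 0"
    and dense: "\<And>f \<epsilon>. f \<in> X \<Longrightarrow> nrm (\<lambda>t. f t - f0 t) < r \<Longrightarrow> \<epsilon> > 0 \<Longrightarrow>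
      \<exists>g\<in>X. q g \<le> real n \<and> nrm (\<lambda>t. f t - g t) < \<epsilon>"
    by blast
  \<comment> \<open>Moving the ball to the origin: \<open>h\<close> is half the difference of \<open>f0 + h\<close> and \<open>f0 - h\<close>.\<close>
  have approx1: "\<exists>g\<in>X. q g \<le> real n \<and> nrm (\<lambda>t. h t - g t) < \<epsilon>"
    if h: "h \<in> X" "nrm h < r" and \<epsilon>: "\<epsilon> > 0" for h \<epsilon>
  proof -
    obtain g1 where g1: "g1 \<in> X" "q g1 \<le> real n" "nrm (\<lambda>t. (f0 t + h t) - g1 t) < \<epsilon>"
      using dense[of "\<lambda>t. f0 t + h t" \<epsilon>] h f0 \<epsilon> add_mem by auto
    obtain g2 where g2: "g2 \<in> X" "q g2 \<le> real n" "nrm (\<lambda>t. (f0 t - h t) - g2 t) < \<epsilon>"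
      using dense[of "\<lambda>t. f0 t - h t" \<epsilon>] h f0 \<epsilon> diff_mem nrm_scale[of h "-1"] by auto
    define g where "g = (\<lambda>t. (1/2) * (g1 t - g2 t))"
    have "g \<in> X" unfolding g_def by (intro scale_mem diff_mem g1 g2)
    moreover have "q g \<le> real n"
      using q_diff[OF g1(1) g2(1)] g1(2) g2(2) q_scale[OF diff_mem[OF g1(1) g2(1)], of "1/2"]
      by (simp add: g_def)
    moreover have "nrm (\<lambda>t. h t - g t) < \<epsilon>"
    proof -
      have m: "(\<lambda>t. (f0 t + h t) - g1 t) \<in> X" "(\<lambda>t. (f0 t - h t) - g2 t) \<in> X"
        by (intro diff_mem add_mem h f0 g1 g2)+
      have "nrm (\<lambda>t. h t - g t) =
          nrm (\<lambda>t. (1/2) * (((f0 t + h t) - g1 t) - ((f0 t - h t) - g2 t)))"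
        by (rule arg_cong[where f = nrm]) (simp add: g_def fun_eq_iff field_simps)
      also have "\<dots> < \<epsilon>"
        using nrm_triangle_diff[OF m] nrm_scale[OF diff_mem[OF m], of "1/2"] g1 g2 by simp
      finally show ?thesis .
    qed
    ultimately show ?thesis by blast
  qed
  have approx: "\<exists>g\<in>X. q g \<le> real n * s \<and> nrm (\<lambda>t. h t - g t) < \<epsilon>"
    if h: "h \<in> X" "nrm h < r * s" and s: "s > 0" and \<epsilon>: "\<epsilon> > 0" for h s \<epsilon>
  proof -
    have "nrm (\<lambda>t. (1/s) * h t) < r"
      using nrm_scale[OF h(1), of "1/s"] h s by (simp add: pos_divide_less_eq)
    then obtain g where g: "g \<in> X" "q g \<le> real n" "nrm (\<lambda>t. (1/s) * h t - g t) < \<epsilon> / s"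
      using approx1[OF scale_mem[OF h(1), of "1/s"], of "\<epsilon>/s"] s \<epsilon> by auto
    have "nrm (\<lambda>t. h t - s * g t) = nrm (\<lambda>t. s * ((1/s) * h t - g t))"
      by (rule arg_cong[where f = nrm]) (use s in \<open>simp add: fun_eq_iff field_simps\<close>)
    also have "\<dots> = s * nrm (\<lambda>t. (1/s) * h t - g t)"
      using nrm_scale[OF diff_mem[OF scale_mem[OF h(1), of "1/s"] g(1)], of s] s by simp
    also have "\<dots> < \<epsilon>" using g(3) s by (simp add: field_simps)
    finally have "nrm (\<lambda>t. h t - s * g t) < \<epsilon>" .
    moreover have "q (\<lambda>t. s * g t) \<le> real n * s"
      using q_scale[OF g(1), of s] g(2) s by (simp add: mult.commute)
    ultimately show ?thesis using scale_mem[OF g(1), of s] by blast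
  qed
  have ball: "q h \<le> 2 * real n" if h: "h \<in> X" "nrm h < r" for h
  proof -
    \<comment> \<open>\<open>e k\<close> is what remains of \<open>h\<close> after \<open>k\<close> approximation steps.\<close>
    let ?P = "\<lambda>k h'. h' \<in> X \<and> nrm h' < r * (1/2) ^ k"
    let ?Q = "\<lambda>k h1 h2. q (\<lambda>t. h1 t - h2 t) \<le> real n * (1/2) ^ k"
    have "\<exists>e. (\<forall>k. ?P k (e k) \<and> ?Q k (e k) (e (Suc k))) \<and> e 0 = h"
    proof -
      let ?P' = "\<lambda>k h'. ?P k h' \<and> (k = 0 \<longrightarrow> h' = h)"
      have "\<exists>e. \<forall>k. ?P' k (e k) \<and> ?Q k (e k) (e (Suc k))"
      proof (rule dependent_nat_choice)
        show "\<exists>x. ?P' 0 x" using h by auto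
      next
        fix h1 k assume h1: "?P' k h1"
        then obtain g where g: "g \<in> X" "q g \<le> real n * (1/2) ^ k"
          "nrm (\<lambda>t. h1 t - g t) < r * (1/2) ^ Suc k"
          using approx[of h1 "(1/2)^k" "r * (1/2) ^ Suc k"] r by auto
        show "\<exists>y. ?P' (Suc k) y \<and> ?Q k h1 y"
          by (rule exI[of _ "\<lambda>t. h1 t - g t"]) (use g h1 diff_mem in auto)
      qed
      then show ?thesis by metis
    qed
    then obtain e where e: "\<And>k. e k \<in> X" "\<And>k. nrm (e k) < r * (1/2) ^ k"
      "\<And>k. q (\<lambda>t. e k t - e (Suc k) t) \<le> real n * (1/2) ^ k" "e 0 = h" by blast
    define u where "u k = (\<lambda>t. e k t - e (Suc k) t)" for k
    have u: "u k \<in> X" for k unfolding u_def by (intro diff_mem e)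
    have geo: "(\<lambda>k. real n * (1/2) ^ k) sums (2 * real n)"
      using sums_mult[OF geometric_sums[of "1/2::real"], of "real n"] by (simp add: mult.commute)
    have le: "q (u k) \<le> real n * (1/2) ^ k" for k using e(3) by (simp add: u_def)
    have sumq: "summable (\<lambda>k. q (u k))"
      by (rule summable_comparison_test[OF _ sums_summable[OF geo]])
        (use le q_nonneg[OF u] in \<open>auto intro!: exI[of _ 0]\<close>)
    have tele: "(\<Sum>k<N. u k t) = h t - e N t" for N t
      using sum_lessThan_telescope'[of "\<lambda>k. e k t" N] by (simp add: u_def e(4))
    have "norm_tendsto nrm (\<lambda>N t. \<Sum>k<N. u k t) h"
      unfolding norm_tendsto_def
    proof (rule tendsto_sandwich[of "\<lambda>_. 0"])
      have "nrm (\<lambda>t. - e N t) \<le> r * (1/2) ^ N" for N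
        using nrm_scale[OF e(1), of "-1" N] e(2)[of N] by simp
      then show "\<forall>\<^sub>F N in sequentially. nrm (\<lambda>t. (\<Sum>k<N. u k t) - h t) \<le> r * (1/2) ^ N"
        by (simp add: tele)
      show "(\<lambda>N. r * (1/2) ^ N) \<longlonglongrightarrow> 0"
        by (intro tendsto_mult_right_zero LIMSEQ_power_zero) simp
    qed (auto simp: nrm_nonneg)
    from q_series[OF u h(1) sumq this] show ?thesis
      using suminf_le[OF le sumq sums_summable[OF geo]] sums_unique[OF geo] by simp
  qed
  have "q h \<le> (4 * real n / r) * nrm h" if h: "h \<in> X" for h
  proof -
    have *: "q h * c \<le> 2 * real n" if "c > 0" "c * nrm h < r" for c
      using ball[OF scale_mem[OF h, of c]] nrm_scale[OF h, of c] q_scale[OF h, of c] that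
      by (simp add: mult.commute)
    show ?thesis
    proof (cases "nrm h = 0")
      case True
      have "q h \<le> 0"
      proof (rule ccontr)
        assume "\<not> q h \<le> 0"
        then have "q h * ((2 * real n + 1) / q h) \<le> 2 * real n"
          by (intro *) (use True r in auto)
        then show False using \<open>\<not> q h \<le> 0\<close> by simp
      qed
      then show ?thesis using True by simp
    next
      case False
      then have pos: "nrm h > 0" using nrm_nonneg[of h] by simp
      have "q h * (r / (2 * nrm h)) \<le> 2 * real n"
        by (rule *) (use pos r in auto)
      then show ?thesis using pos r by (simp add: field_simps)
    qed
  qed
  then show ?thesis using r by (intro exI[of _ "4 * real n / r"]) auto
qed

end

lemma closed_subspace_complete:
  assumes p: "1 \<le> p" and X: "closed_linear_subspace (Lp_norm M p) (Lp_space M p) X"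
  shows "complete_seminormed_space (Lp_norm M p) X"
proof
  have sub: "X \<subseteq> Lp_space M p" using X by (simp add: closed_linear_subspace_def)
  have closed: "\<forall>f g. (\<forall>n. f n \<in> X) \<and> g \<in> Lp_space M p \<and>
      norm_tendsto (Lp_norm M p) f g \<longrightarrow> g \<in> X"
    using X unfolding closed_linear_subspace_def by (elim conjE)
  show zero: "(\<lambda>t. 0) \<in> X" using X by (simp add: closed_linear_subspace_def)
  show add: "(\<lambda>t. f t + g t) \<in> X" if "f \<in> X" "g \<in> X" for f g
    using X that by (simp add: closed_linear_subspace_def)
  show "(\<lambda>t. c * f t) \<in> X" if "f \<in> X" for f c
    using X that by (simp add: closed_linear_subspace_def)
  show "0 \<le> Lp_norm M p f" for f by (rule Lp_norm_nonneg)
  show "Lp_norm M p (\<lambda>t. f t + g t) \<le> Lp_norm M p f + Lp_norm M p g" if "f \<in> X" "g \<in> X" for f g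
    using sub that by (intro Minkowski p) auto
  show "Lp_norm M p (\<lambda>t. c * f t) = \<bar>c\<bar> * Lp_norm M p f" if "f \<in> X" for f c
    using p by (intro Lp_norm_scale) simp
  show "\<exists>g\<in>X. norm_tendsto (Lp_norm M p) (\<lambda>n t. \<Sum>k<n. u k t) g"
    if u: "\<And>n. u n \<in> X" and s: "summable (\<lambda>n. Lp_norm M p (u n))" for u
  proof -
    obtain g where g: "g \<in> Lp_space M p" "norm_tendsto (Lp_norm M p) (\<lambda>n t. \<Sum>k<n. u k t) g"
      using Lp_complete[OF p _ s] u sub by blast
    have "(\<lambda>t. \<Sum>k<n. u k t) \<in> X" for n
    proof (induction n)
      case (Suc n)
      then show ?case using add[OF Suc u[of n]] by simp
    qed (simp add: zero)
    then have "g \<in> X"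
      using closed[rule_format, of "\<lambda>n t. \<Sum>k<n. u k t" g] g by simp
    then show ?thesis using g by blast
  qed
qed

section \<open>Rearrangements and finite partial sums\<close>

text \<open>Bijections between corresponding finite blocks glue to a single bijection; this produces the
rearrangement that contradicts unconditional convergence below.\<close>
lemma finite_blocks_bijection:
  fixes A :: "'i \<Rightarrow> 'a set" and B :: "'i \<Rightarrow> 'b set"
  assumes disjA: "disjoint_family A" and disjB: "disjoint_family B"
    and fin: "\<And>i. finite (A i)" "\<And>i. finite (B i)" and card: "\<And>i. card (A i) = card (B i)"
  obtains \<pi> where "bij_betw \<pi> (\<Union>i. A i) (\<Union>i. B i)" "\<And>i. \<pi> ` A i = B i"
proof -
  obtain h where h: "\<And>i. bij_betw (h i) (A i) (B i)"
    using finite_same_card_bij[OF fin card] by metis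
  define \<pi> where "\<pi> x = h (THE i. x \<in> A i) x" for x
  have "\<pi> x = h i x" if "x \<in> A i" for i x
  proof -
    have "(THE i. x \<in> A i) = i"
      using that disjA by (intro the_equality) (auto simp: disjoint_family_on_def)
    then show ?thesis by (simp add: \<pi>_def)
  qed
  then have *: "bij_betw \<pi> (A i) (B i)" for i
    using h[of i] bij_betw_cong[of "A i" \<pi> "h i" "B i"] by simp
  show ?thesis
    by (rule that[of \<pi>]) (use * disjB in \<open>auto intro: bij_betw_UNION_disjoint simp: bij_betw_imp_surj_on\<close>)
qed

context complete_seminormed_space
begin

text \<open>If the finite sums were unbounded, then beyond every index there would be a finite set whose sum has
norm greater than \<open>1\<close>, because the contribution of the initial terms is bounded. Cut the natural
numbers into consecutive blocks \<open>{N k..<N (Suc k)}\<close>, each containing such a set, and rearrange every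
block so that its set comes first. The partial sums of this rearrangement are not Cauchy.\<close>
lemma rearrangements_convergent_imp_finite_sums_bounded:
  assumes u: "\<And>n. u n \<in> X"
    and conv: "\<And>\<pi>. bij \<pi> \<Longrightarrow> \<exists>g\<in>X. norm_tendsto nrm (\<lambda>n t. \<Sum>i<n. u (\<pi> i :: nat) t) g"
  shows "\<exists>B. \<forall>F. finite F \<longrightarrow> nrm (\<lambda>t. \<Sum>i\<in>F. u i t) \<le> B"
proof (rule ccontr)
  assume "\<not> ?thesis"
  then have unbounded: "\<exists>F. finite F \<and> B < nrm (\<lambda>t. \<Sum>i\<in>F. u i t)" for B
    by (meson not_less)
  have "\<exists>E. finite E \<and> E \<subseteq> {n..} \<and> 1 < nrm (\<lambda>t. \<Sum>i\<in>E. u i t)" for n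
  proof -
    obtain F where F: "finite F" "1 + (\<Sum>i<n. nrm (u i)) < nrm (\<lambda>t. \<Sum>i\<in>F. u i t)"
      using unbounded by blast
    have "nrm (\<lambda>t. \<Sum>i\<in>F. u i t) = nrm (\<lambda>t. (\<Sum>i\<in>F \<inter> {n..}. u i t) + (\<Sum>i\<in>F \<inter> {..<n}. u i t))"
    proof (rule arg_cong[where f = nrm], rule ext)
      fix t
      have "(\<Sum>i\<in>F. u i t) = (\<Sum>i\<in>(F \<inter> {n..}) \<union> (F \<inter> {..<n}). u i t)"
        by (rule sum.cong) auto
      also have "\<dots> = (\<Sum>i\<in>F \<inter> {n..}. u i t) + (\<Sum>i\<in>F \<inter> {..<n}. u i t)"
        using F(1) by (intro sum.union_disjoint) auto
      finally show "(\<Sum>i\<in>F. u i t) = (\<Sum>i\<in>F \<inter> {n..}. u i t) + (\<Sum>i\<in>F \<inter> {..<n}. u i t)" .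
    qed
    also have "\<dots> \<le> nrm (\<lambda>t. \<Sum>i\<in>F \<inter> {n..}. u i t) + nrm (\<lambda>t. \<Sum>i\<in>F \<inter> {..<n}. u i t)"
      by (intro nrm_triangle sum_mem u)
    also have "nrm (\<lambda>t. \<Sum>i\<in>F \<inter> {..<n}. u i t) \<le> (\<Sum>i\<in>F \<inter> {..<n}. nrm (u i))"
      by (intro nrm_sum_le u)
    also have "\<dots> \<le> (\<Sum>i<n. nrm (u i))" by (intro sum_mono2) (auto simp: nrm_nonneg)
    finally have "1 < nrm (\<lambda>t. \<Sum>i\<in>F \<inter> {n..}. u i t)" using F(2) by linarith
    then show ?thesis using F(1) by (intro exI[of _ "F \<inter> {n..}"]) auto
  qed
  then obtain E where E: "\<And>n. finite (E n)" "\<And>n. E n \<subseteq> {n..}"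
    "\<And>n. 1 < nrm (\<lambda>t. \<Sum>i\<in>E n. u i t)" by metis
  define nxt where "nxt n = Suc (Max (insert n (E n)))" for n
  have nxt: "n < nxt n" "E n \<subseteq> {n..<nxt n}" for n
    using E(1)[of n] E(2)[of n] by (auto simp: nxt_def less_Suc_eq_le)
  define N where "N k = (nxt ^^ k) 0" for k
  have N: "N 0 = 0" "N (Suc k) = nxt (N k)" for k by (simp_all add: N_def)
  have smono: "strict_mono N" unfolding strict_mono_Suc_iff using N nxt by simp
  \<comment> \<open>Block \<open>k\<close> is split twice into two pieces, indexed by a Boolean: \<open>A\<close> lists the new positions,
    the first of which receive the set \<open>E (N k)\<close>, and \<open>B\<close> the indices placed there.\<close>
  define A where "A z = (case z of (k, b) \<Rightarrow>
    if b then {N k..<N k + card (E (N k))} else {N k + card (E (N k))..<N (Suc k)})" for z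
  define B where "B z = (case z of (k, b) \<Rightarrow>
    if b then E (N k) else {N k..<N (Suc k)} - E (N k))" for z
  have E_sub: "E (N k) \<subseteq> {N k..<N (Suc k)}" for k using nxt(2)[of "N k"] N by simp
  have card_E: "card (E (N k)) \<le> N (Suc k) - N k" for k
    using card_mono[OF _ E_sub[of k]] by simp
  have N_less: "N k < N (Suc k)" for k using smono by (simp add: strict_mono_Suc_iff)
  have AB_sub: "A (k, b) \<subseteq> {N k..<N (Suc k)}" "B (k, b) \<subseteq> {N k..<N (Suc k)}" for k b
    using E_sub[of k] card_E[of k] N_less[of k] by (auto simp: A_def B_def)
  have disj_blocks: "{N j..<N (Suc j)} \<inter> {N k..<N (Suc k)} = {}" if "j \<noteq> k" for j k
    using that
  proof (induction j k rule: linorder_wlog)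
    case (le j k)
    then have "N (Suc j) \<le> N k" using smono by (simp add: strict_mono_less_eq Suc_le_eq)
    then show ?case by auto
  qed auto
  have disj: "disjoint_family A" "disjoint_family B"
  proof -
    have "A (j, b) \<inter> A (k, c) = {} \<and> B (j, b) \<inter> B (k, c) = {}" if "(j, b) \<noteq> (k, c)" for j b k c
    proof (cases "j = k")
      case True
      then show ?thesis using that by (auto simp: A_def B_def)
    next
      case False
      then show ?thesis using disj_blocks AB_sub by blast
    qed
    then show "disjoint_family A" "disjoint_family B"
      unfolding disjoint_family_on_def by auto
  qed
  have cover: "(\<Union>k. {N k..<N (Suc k)}) = UNIV"
  proof -
    have "\<exists>k. i \<in> {N k..<N (Suc k)}" for i
    proof (induction i)
      case 0
      then show ?case using N nxt(1)[of 0] by (intro exI[of _ 0]) simp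
    next
      case (Suc i)
      then obtain k where k: "N k \<le> i" "i < N (Suc k)" by auto
      then show ?case
        using N_less[of "Suc k"]
        by (cases "Suc i < N (Suc k)") (auto intro: exI[of _ k] exI[of _ "Suc k"])
    qed
    then show ?thesis by auto
  qed
  have UA: "(\<Union>z. A z) = UNIV" and UB: "(\<Union>z. B z) = UNIV"
  proof -
    have "N k + card (E (N k)) \<le> N (Suc k)" for k using card_E[of k] N_less[of k] by linarith
    then have "A (k, True) \<union> A (k, False) = {N k..<N (Suc k)}" for k
      unfolding A_def by (simp add: ivl_disj_un_two(3))
    then have "{N k..<N (Suc k)} \<subseteq> (\<Union>z. A z)" for k by blast
    then show "(\<Union>z. A z) = UNIV" using UN_least[of UNIV "\<lambda>k. {N k..<N (Suc k)}"] cover by (simp add: top_unique)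
    have "B (k, True) \<union> B (k, False) = {N k..<N (Suc k)}" for k
      unfolding B_def prod.case using E_sub[of k] by auto
    then have "{N k..<N (Suc k)} \<subseteq> (\<Union>z. B z)" for k by blast
    then show "(\<Union>z. B z) = UNIV" using UN_least[of UNIV "\<lambda>k. {N k..<N (Suc k)}"] cover by (simp add: top_unique)
  qed
  have finAB: "finite (A z)" "finite (B z)" for z
    using E(1) by (simp_all add: A_def B_def split: prod.split)
  have card_AB: "card (A z) = card (B z)" for z
    by (simp add: A_def B_def card_Diff_subset[OF E(1) E_sub] split: prod.split)
  obtain \<pi> where \<pi>: "bij_betw \<pi> (\<Union>z. A z) (\<Union>z. B z)" "\<And>z. \<pi> ` A z = B z"
    using finite_blocks_bijection[OF disj finAB card_AB] by blast
  then have "bij \<pi>" using UA UB by simp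
  from conv[OF this] obtain g where g: "g \<in> X"
    and lim: "(\<lambda>n. nrm (\<lambda>t. (\<Sum>i<n. u (\<pi> i) t) - g t)) \<longlonglongrightarrow> 0"
    unfolding norm_tendsto_def by blast
  obtain M where M: "\<And>n. n \<ge> M \<Longrightarrow> nrm (\<lambda>t. (\<Sum>i<n. u (\<pi> i) t) - g t) < 1 / 2"
    using LIMSEQ_D[OF lim, of "1/2"] by (auto simp: nrm_nonneg)
  let ?n = "N M" and ?m = "N M + card (E (N M))"
  have part: "(\<lambda>t. \<Sum>i<n. u (\<pi> i) t) \<in> X" for n by (intro sum_mem u)
  have "M \<le> ?n" using strict_mono_imp_increasing[OF smono] .
  then have "nrm (\<lambda>t. (\<Sum>i<?m. u (\<pi> i) t) - (\<Sum>i<?n. u (\<pi> i) t)) < 1"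
    using nrm_triangle_via[OF part g part, of ?m ?n] M[of ?n] M[of ?m]
      nrm_minus_commute[OF part g, of ?n] by simp
  moreover have "(\<Sum>i<?m. u (\<pi> i) t) - (\<Sum>i<?n. u (\<pi> i) t) = (\<Sum>i\<in>E (N M). u i t)" for t
  proof -
    have "(\<Sum>i<?m. u (\<pi> i) t) - (\<Sum>i<?n. u (\<pi> i) t) = (\<Sum>i\<in>{?n..<?m}. u (\<pi> i) t)"
      using sum_diff_nat_ivl[of 0 ?n ?m "\<lambda>i. u (\<pi> i) t"] by (simp add: atLeast0LessThan)
    also have "\<dots> = (\<Sum>i\<in>\<pi> ` {?n..<?m}. u i t)"
      using \<open>bij \<pi>\<close> by (subst sum.reindex) (auto intro: inj_on_subset[OF bij_is_inj])
    also have "\<pi> ` {?n..<?m} = E (N M)" using \<pi>(2)[of "(M, True)"] by (simp add: A_def B_def)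
    finally show ?thesis .
  qed
  ultimately show False using E(3)[of "N M"] by simp
qed

end

section \<open>Uniform boundedness of coordinate projections\<close>

locale unconditional_expansion = complete_seminormed_space nrm X
  for nrm :: "('s \<Rightarrow> real) \<Rightarrow> real" and X +
  fixes d :: enat and x :: "nat \<Rightarrow> 's \<Rightarrow> real"
  assumes basis: "unconditional_basis nrm X d x"
begin

definition coef :: "('s \<Rightarrow> real) \<Rightarrow> nat \<Rightarrow> real" where
  "coef f = (THE a. coeff_seq d a \<and> series_to nrm x a f)"

lemma coef_ex1: "f \<in> X \<Longrightarrow> \<exists>!a. coeff_seq d a \<and> series_to nrm x a f"
  using basis unfolding unconditional_basis_def schauder_basis_def by blast

lemma coef: "f \<in> X \<Longrightarrow> coeff_seq d (coef f)" "f \<in> X \<Longrightarrow> series_to nrm x (coef f) f"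
  using theI'[OF coef_ex1] unfolding coef_def by auto

lemma coef_unique: "f \<in> X \<Longrightarrow> coeff_seq d a \<Longrightarrow> series_to nrm x a f \<Longrightarrow> coef f = a"
  using coef_ex1 coef by blast

lemma term_mem: "coeff_seq d a \<Longrightarrow> (\<lambda>t. a i * x i t) \<in> X"
proof (cases "enat i < d")
  case True
  then show ?thesis using basis scale_mem unfolding unconditional_basis_def schauder_basis_def by blast
next
  case False
  assume "coeff_seq d a"
  then show ?thesis using False zero_mem by (simp add: coeff_seq_def not_less)
qed

lemma finite_sum_mem: "coeff_seq d a \<Longrightarrow> (\<lambda>t. \<Sum>i\<in>F. a i * x i t) \<in> X"
  by (intro sum_mem term_mem)

lemma series_toI_le:
  assumes "\<And>n. nrm (\<lambda>t. (\<Sum>i<n. a i * x i t) - f t) \<le> e n" "e \<longlonglongrightarrow> 0"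
  shows "series_to nrm x a f"
  unfolding series_to_def norm_tendsto_def
  by (rule tendsto_sandwich[of "\<lambda>_. 0" _ _ e]) (use assms nrm_nonneg in auto)

lemma coef_add:
  assumes f: "f \<in> X" and g: "g \<in> X"
  shows "coef (\<lambda>t. f t + g t) = (\<lambda>i. coef f i + coef g i)"
proof (rule coef_unique)
  show "series_to nrm x (\<lambda>i. coef f i + coef g i) (\<lambda>t. f t + g t)"
  proof (rule series_toI_le)
    fix n
    have "nrm (\<lambda>t. (\<Sum>i<n. (coef f i + coef g i) * x i t) - (f t + g t)) =
        nrm (\<lambda>t. ((\<Sum>i<n. coef f i * x i t) - f t) + ((\<Sum>i<n. coef g i * x i t) - g t))"
      by (rule arg_cong[where f = nrm]) (simp add: distrib_right sum.distrib fun_eq_iff)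
    also have "\<dots> \<le> nrm (\<lambda>t. (\<Sum>i<n. coef f i * x i t) - f t) + nrm (\<lambda>t. (\<Sum>i<n. coef g i * x i t) - g t)"
      by (intro nrm_triangle diff_mem finite_sum_mem coef f g)
    finally show "nrm (\<lambda>t. (\<Sum>i<n. (coef f i + coef g i) * x i t) - (f t + g t)) \<le> \<dots>" .
  next
    show "(\<lambda>n. nrm (\<lambda>t. (\<Sum>i<n. coef f i * x i t) - f t) + nrm (\<lambda>t. (\<Sum>i<n. coef g i * x i t) - g t)) \<longlonglongrightarrow> 0"
      using tendsto_add[OF coef(2)[OF f, unfolded series_to_def norm_tendsto_def]
          coef(2)[OF g, unfolded series_to_def norm_tendsto_def]] by simp
  qed
qed (use coef(1)[OF f] coef(1)[OF g] in \<open>auto simp: coeff_seq_def intro: add_mem f g\<close>)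

lemma coef_scale:
  assumes f: "f \<in> X"
  shows "coef (\<lambda>t. c * f t) = (\<lambda>i. c * coef f i)"
proof (rule coef_unique)
  show "series_to nrm x (\<lambda>i. c * coef f i) (\<lambda>t. c * f t)"
  proof (rule series_toI_le)
    fix n
    have "(\<lambda>t. (\<Sum>i<n. c * coef f i * x i t) - c * f t) = (\<lambda>t. c * ((\<Sum>i<n. coef f i * x i t) - f t))"
      by (simp add: sum_distrib_left right_diff_distrib mult.assoc)
    then show "nrm (\<lambda>t. (\<Sum>i<n. c * coef f i * x i t) - c * f t) \<le> \<bar>c\<bar> * nrm (\<lambda>t. (\<Sum>i<n. coef f i * x i t) - f t)"
      using nrm_scale[OF diff_mem[OF finite_sum_mem[OF coef(1)[OF f]] f]] by simp
  next
    show "(\<lambda>n. \<bar>c\<bar> * nrm (\<lambda>t. (\<Sum>i<n. coef f i * x i t) - f t)) \<longlonglongrightarrow> 0"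
      using coef(2)[OF f] by (intro tendsto_mult_right_zero) (simp add: series_to_def norm_tendsto_def)
  qed
qed (use coef(1)[OF f] in \<open>auto simp: coeff_seq_def intro: scale_mem f\<close>)

lemma coef_zero: "coef (\<lambda>t. 0) = (\<lambda>i. 0)"
  using coef_scale[OF zero_mem, of 0] by simp

lemma coef_sum:
  "(\<And>k. u k \<in> X) \<Longrightarrow> coef (\<lambda>t. \<Sum>k<n. u k t) = (\<lambda>i. \<Sum>k<n. coef (u k) i)" for n :: nat
proof (induction n)
  case (Suc n)
  then show ?case using coef_add[of "\<lambda>t. \<Sum>k<n. u k t" "u n"] by (simp add: sum_mem)
qed (simp add: coef_zero)

lemma coef_finite_sum:
  assumes F: "finite F" and a: "coeff_seq d a" "\<And>i. i \<notin> F \<Longrightarrow> a i = 0"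
  shows "coef (\<lambda>t. \<Sum>i\<in>F. a i * x i t) = a"
proof (rule coef_unique[OF finite_sum_mem[OF a(1)] a(1)])
  obtain m where m: "F \<subseteq> {..<m}" using F finite_nat_iff_bounded by blast
  have "(\<Sum>i<n. a i * x i t) = (\<Sum>i\<in>F. a i * x i t)" if "m \<le> n" for n t
    using m that a(2) by (intro sum.mono_neutral_right) auto
  then have "\<forall>\<^sub>F n in sequentially. nrm (\<lambda>t. (\<Sum>i<n. a i * x i t) - (\<Sum>i\<in>F. a i * x i t)) = 0"
    unfolding eventually_sequentially by (intro exI[of _ m]) (simp add: nrm_zero)
  then show "series_to nrm x a (\<lambda>t. \<Sum>i\<in>F. a i * x i t)"
    unfolding series_to_def norm_tendsto_def by (rule tendsto_eventually)
qed

text \<open>A basis vector of norm zero would be the limit of both the zero series and its own one-term series.\<close>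
lemma nrm_basis_pos:
  assumes "enat i < d"
  shows "0 < nrm (x i)"
proof (rule ccontr)
  assume "\<not> ?thesis"
  then have z: "nrm (x i) = 0" using nrm_nonneg[of "x i"] by simp
  have xX: "x i \<in> X" using basis assms unfolding unconditional_basis_def schauder_basis_def by blast
  define e where "e j = (if j = i then 1 else 0 :: real)" for j
  have "coeff_seq d e" using assms by (auto simp: coeff_seq_def e_def)
  then have "coef (\<lambda>t. \<Sum>j\<in>{i}. e j * x j t) = e"
    by (rule coef_finite_sum[rotated]) (simp_all add: e_def)
  moreover have "(\<lambda>t. \<Sum>j\<in>{i}. e j * x j t) = x i" by (simp add: e_def)
  ultimately have "coef (x i) = e" by simp
  moreover have "coef (x i) = (\<lambda>_. 0)"
  proof (rule coef_unique[OF xX])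
    show "series_to nrm x (\<lambda>_. 0) (x i)"
      using nrm_scale[OF xX, of "-1"] z by (simp add: series_to_def norm_tendsto_def)
  qed (simp add: coeff_seq_def)
  ultimately have "e i = 0" by metis
  then show False by (simp add: e_def)
qed

lemma finite_coef_sums_bounded:
  assumes f: "f \<in> X"
  shows "\<exists>B. \<forall>F. finite F \<longrightarrow> nrm (\<lambda>t. \<Sum>i\<in>F. coef f i * x i t) \<le> B"
proof (rule rearrangements_convergent_imp_finite_sums_bounded[of "\<lambda>i t. coef f i * x i t"])
  show "(\<lambda>t. coef f n * x n t) \<in> X" for n by (rule term_mem[OF coef(1)[OF f]])
  fix \<pi> :: "nat \<Rightarrow> nat" assume "bij \<pi>"
  then obtain g where "g \<in> X" "series_to nrm (x \<circ> \<pi>) (coef f \<circ> \<pi>) g"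
    using basis coef[OF f] f unfolding unconditional_basis_def by meson
  then show "\<exists>g\<in>X. norm_tendsto nrm (\<lambda>n t. \<Sum>i<n. coef f (\<pi> i) * x (\<pi> i) t) g"
    unfolding series_to_def comp_def by blast
qed

text \<open>The equivalent norm in which all coordinate projections onto finite sets are contractions. Its
finiteness at each \<open>f\<close> is unconditional convergence; its domination by \<open>nrm\<close> is proved below.\<close>
definition projection_norm :: "('s \<Rightarrow> real) \<Rightarrow> real" where
  "projection_norm f = (SUP F\<in>{F. finite F}. nrm (\<lambda>t. \<Sum>i\<in>F. coef f i * x i t))"

lemma projection_norm_upper:
  assumes "f \<in> X" "finite F"
  shows "nrm (\<lambda>t. \<Sum>i\<in>F. coef f i * x i t) \<le> projection_norm f"
proof -
  obtain B where B: "\<And>F. finite F \<Longrightarrow> nrm (\<lambda>t. \<Sum>i\<in>F. coef f i * x i t) \<le> B"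
    using finite_coef_sums_bounded[OF assms(1)] by blast
  have "bdd_above ((\<lambda>F. nrm (\<lambda>t. \<Sum>i\<in>F. coef f i * x i t)) ` {F. finite F})"
    by (rule bdd_aboveI2[of _ _ B]) (simp add: B)
  then show ?thesis
    unfolding projection_norm_def
    using cSUP_upper[of F "{F. finite F}" "\<lambda>F. nrm (\<lambda>t. \<Sum>i\<in>F. coef f i * x i t)"] assms(2) by simp
qed

lemma projection_norm_least:
  assumes "\<And>F. finite F \<Longrightarrow> nrm (\<lambda>t. \<Sum>i\<in>F. coef f i * x i t) \<le> B"
  shows "projection_norm f \<le> B"
  unfolding projection_norm_def
proof (rule cSUP_least)
  show "{F :: nat set. finite F} \<noteq> {}" by blast
qed (simp add: assms)

lemma projection_norm_nonneg: "f \<in> X \<Longrightarrow> 0 \<le> projection_norm f"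
  using projection_norm_upper[of f "{}"] by (simp add: nrm_zero)

lemma projection_norm_triangle:
  assumes f: "f \<in> X" and g: "g \<in> X"
  shows "projection_norm (\<lambda>t. f t + g t) \<le> projection_norm f + projection_norm g"
proof (rule projection_norm_least)
  fix F :: "nat set" assume F: "finite F"
  have "nrm (\<lambda>t. \<Sum>i\<in>F. coef (\<lambda>t. f t + g t) i * x i t) =
      nrm (\<lambda>t. (\<Sum>i\<in>F. coef f i * x i t) + (\<Sum>i\<in>F. coef g i * x i t))"
    by (simp add: coef_add f g distrib_right sum.distrib)
  also have "\<dots> \<le> nrm (\<lambda>t. \<Sum>i\<in>F. coef f i * x i t) + nrm (\<lambda>t. \<Sum>i\<in>F. coef g i * x i t)"
    by (intro nrm_triangle finite_sum_mem coef f g)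
  also have "\<dots> \<le> projection_norm f + projection_norm g"
    by (intro add_mono projection_norm_upper f g F)
  finally show "nrm (\<lambda>t. \<Sum>i\<in>F. coef (\<lambda>t. f t + g t) i * x i t) \<le> \<dots>" .
qed

lemma projection_norm_scale:
  assumes f: "f \<in> X"
  shows "projection_norm (\<lambda>t. c * f t) = \<bar>c\<bar> * projection_norm f"
proof -
  have le: "projection_norm (\<lambda>t. c * g t) \<le> \<bar>c\<bar> * projection_norm g" if g: "g \<in> X" for c g
  proof (rule projection_norm_least)
    fix F :: "nat set" assume F: "finite F"
    have "nrm (\<lambda>t. \<Sum>i\<in>F. coef (\<lambda>t. c * g t) i * x i t) = nrm (\<lambda>t. c * (\<Sum>i\<in>F. coef g i * x i t))"
      by (simp add: coef_scale g sum_distrib_left mult.assoc)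
    also have "\<dots> = \<bar>c\<bar> * nrm (\<lambda>t. \<Sum>i\<in>F. coef g i * x i t)"
      by (intro nrm_scale finite_sum_mem coef g)
    also have "\<dots> \<le> \<bar>c\<bar> * projection_norm g" by (intro mult_left_mono projection_norm_upper g F) simp
    finally show "nrm (\<lambda>t. \<Sum>i\<in>F. coef (\<lambda>t. c * g t) i * x i t) \<le> \<dots>" .
  qed
  show ?thesis
  proof (cases "c = 0")
    case True
    then show ?thesis using le[OF f, of 0] projection_norm_nonneg[OF zero_mem] by simp
  next
    case False
    then have "projection_norm f \<le> \<bar>1 / c\<bar> * projection_norm (\<lambda>t. c * f t)"
      using le[OF scale_mem[OF f, of c], of "1 / c"] by simp
    then have "\<bar>c\<bar> * projection_norm f \<le> projection_norm (\<lambda>t. c * f t)"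
      using False by (simp add: field_simps)
    then show ?thesis using le[OF f, of c] by simp
  qed
qed

text \<open>The coefficients of the \<open>u k\<close> sum to coefficients \<open>b\<close>, because each of them is controlled by
\<open>projection_norm (u k)\<close>. The same control, uniform over finite index sets, shows that \<open>b\<close> expands
\<open>f\<close>; by uniqueness of expansions \<open>b\<close> is the coefficient sequence of \<open>f\<close>, and the bound passes to
the limit.\<close>
lemma projection_norm_countably_subadditive:
  assumes u: "\<And>k. u k \<in> X" and f: "f \<in> X" and sum: "summable (\<lambda>k. projection_norm (u k))"
    and lim: "norm_tendsto nrm (\<lambda>n t. \<Sum>k<n. u k t) f"
  shows "projection_norm f \<le> (\<Sum>k. projection_norm (u k))"
proof -
  \<comment> \<open>\<open>T N\<close> bounds all finite partial sums of what remains after the first \<open>N\<close> summands.\<close>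
  define T where "T N = (\<Sum>k. projection_norm (u (k + N)))" for N
  define b where "b i = (\<Sum>k. coef (u k) i)" for i
  have T_lim: "T \<longlonglongrightarrow> 0" unfolding T_def by (rule suminf_exist_split2[OF sum])
  have summable_coef: "summable (\<lambda>k. coef (u k) i)" for i
  proof (cases "enat i < d")
    case True
    have xX: "x i \<in> X" using basis True unfolding unconditional_basis_def schauder_basis_def by blast
    have "\<bar>coef (u k) i\<bar> * nrm (x i) \<le> projection_norm (u k)" for k
      using projection_norm_upper[OF u, of "{i}" k] nrm_scale[OF xX] by simp
    then have "\<bar>coef (u k) i\<bar> \<le> projection_norm (u k) / nrm (x i)" for k
      using nrm_basis_pos[OF True] by (simp add: pos_le_divide_eq)
    then show ?thesis
      by (intro summable_comparison_test[OF _ summable_divide[OF sum]]) auto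
  next
    case False
    then have "coef (u k) i = 0" for k using coef(1)[OF u[of k]] by (simp add: coeff_seq_def not_less)
    then show ?thesis by simp
  qed
  have b: "coeff_seq d b"
    using coef(1)[OF u] by (simp add: coeff_seq_def b_def)
  have tail_seq: "coeff_seq d (\<lambda>i. b i - (\<Sum>k<N. coef (u k) i))" for N
    using b coef(1)[OF u] by (auto simp: coeff_seq_def)
  have tail: "nrm (\<lambda>t. \<Sum>i\<in>F. (b i - (\<Sum>k<N. coef (u k) i)) * x i t) \<le> T N"
    if F: "finite F" for F N
  proof -
    define c where "c m i = (\<Sum>k<m. coef (u (k + N)) i)" for m i
    have c_seq: "coeff_seq d (c m)" for m using coef(1)[OF u] by (auto simp: coeff_seq_def c_def)
    have c_lim: "(\<lambda>m. c m i) \<longlonglongrightarrow> b i - (\<Sum>k<N. coef (u k) i)" for i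
      unfolding c_def b_def using summable_LIMSEQ[OF summable_ignore_initial_segment[OF summable_coef, of N]]
        suminf_minus_initial_segment[OF summable_coef, of N] by simp
    define r where "r i = b i - (\<Sum>k<N. coef (u k) i)" for i
    have r_seq: "coeff_seq d r" unfolding r_def by (rule tail_seq)
    have c_le: "nrm (\<lambda>t. \<Sum>i\<in>F. c m i * x i t) \<le> T N" for m
    proof -
      have "nrm (\<lambda>t. \<Sum>i\<in>F. c m i * x i t) = nrm (\<lambda>t. \<Sum>k<m. \<Sum>i\<in>F. coef (u (k + N)) i * x i t)"
        unfolding c_def by (subst sum.swap) (simp add: sum_distrib_right)
      also have "\<dots> \<le> (\<Sum>k<m. nrm (\<lambda>t. \<Sum>i\<in>F. coef (u (k + N)) i * x i t))"
        by (intro nrm_sum_le finite_sum_mem coef u)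
      also have "\<dots> \<le> (\<Sum>k<m. projection_norm (u (k + N)))"
        by (intro sum_mono projection_norm_upper u F)
      also have "\<dots> \<le> T N" unfolding T_def
        by (intro sum_le_suminf summable_ignore_initial_segment sum) (auto intro: projection_norm_nonneg u)
      finally show ?thesis .
    qed
    have "nrm (\<lambda>t. \<Sum>i\<in>F. r i * x i t) \<le> (\<Sum>i\<in>F. \<bar>r i - c m i\<bar> * nrm (x i)) + T N" for m
    proof -
      have rc: "coeff_seq d (\<lambda>i. r i - c m i)" using r_seq c_seq[of m] by (auto simp: coeff_seq_def)
      have term_nrm: "nrm (\<lambda>t. (r i - c m i) * x i t) \<le> \<bar>r i - c m i\<bar> * nrm (x i)" for i
      proof (cases "enat i < d")
        case True
        then have "x i \<in> X" using basis unfolding unconditional_basis_def schauder_basis_def by blast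
        then show ?thesis using nrm_scale by simp
      next
        case False
        then have "r i - c m i = 0" using rc by (simp add: coeff_seq_def not_less)
        then show ?thesis by (simp add: nrm_zero)
      qed
      have "nrm (\<lambda>t. \<Sum>i\<in>F. r i * x i t) \<le>
          nrm (\<lambda>t. (\<Sum>i\<in>F. r i * x i t) - (\<Sum>i\<in>F. c m i * x i t)) + nrm (\<lambda>t. \<Sum>i\<in>F. c m i * x i t)"
        by (intro nrm_le_diff_add finite_sum_mem r_seq c_seq)
      also have "nrm (\<lambda>t. (\<Sum>i\<in>F. r i * x i t) - (\<Sum>i\<in>F. c m i * x i t)) =
          nrm (\<lambda>t. \<Sum>i\<in>F. (r i - c m i) * x i t)"
        by (simp add: sum_subtractf left_diff_distrib)
      also have "\<dots> \<le> (\<Sum>i\<in>F. nrm (\<lambda>t. (r i - c m i) * x i t))"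
        by (intro nrm_sum_le term_mem rc)
      also have "\<dots> \<le> (\<Sum>i\<in>F. \<bar>r i - c m i\<bar> * nrm (x i))" by (intro sum_mono term_nrm)
      finally show ?thesis using c_le[of m] by linarith
    qed
    moreover have "(\<lambda>m. (\<Sum>i\<in>F. \<bar>r i - c m i\<bar> * nrm (x i)) + T N) \<longlonglongrightarrow> (\<Sum>i\<in>F. \<bar>r i - r i\<bar> * nrm (x i)) + T N"
      using c_lim unfolding r_def by (intro tendsto_intros)
    ultimately have "nrm (\<lambda>t. \<Sum>i\<in>F. r i * x i t) \<le> (\<Sum>i\<in>F. \<bar>r i - r i\<bar> * nrm (x i)) + T N"
      by (intro LIMSEQ_le_const) auto
    then show ?thesis by (simp add: r_def)
  qed
  have "series_to nrm x b f"
    unfolding series_to_def norm_tendsto_def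
  proof (rule LIMSEQ_I)
    fix e :: real assume e: "0 < e"
    have "\<forall>\<^sub>F N in sequentially. T N < e / 3 \<and> nrm (\<lambda>t. (\<Sum>k<N. u k t) - f t) < e / 3"
      using order_tendstoD(2)[OF T_lim, of "e/3"] order_tendstoD(2)[OF lim[unfolded norm_tendsto_def], of "e/3"] e
      by (intro eventually_conj) auto
    then obtain N where N: "T N < e / 3" "nrm (\<lambda>t. (\<Sum>k<N. u k t) - f t) < e / 3"
      by (auto simp: eventually_sequentially)
    define g where "g = (\<lambda>t. \<Sum>k<N. u k t)"
    have g: "g \<in> X" unfolding g_def by (intro sum_mem u)
    have cg: "coef g = (\<lambda>i. \<Sum>k<N. coef (u k) i)" unfolding g_def by (rule coef_sum[OF u])
    obtain m where m: "\<And>n. n \<ge> m \<Longrightarrow> nrm (\<lambda>t. (\<Sum>i<n. coef g i * x i t) - g t) < e / 3"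
      using LIMSEQ_D[OF coef(2)[OF g, unfolded series_to_def norm_tendsto_def], of "e/3"] e
      by (auto simp: nrm_nonneg)
    have "nrm (\<lambda>t. (\<Sum>i<n. b i * x i t) - f t) < e" if n: "n \<ge> m" for n
    proof -
      have "nrm (\<lambda>t. (\<Sum>i<n. b i * x i t) - f t) \<le>
          nrm (\<lambda>t. (\<Sum>i<n. b i * x i t) - (\<Sum>i<n. coef g i * x i t)) + nrm (\<lambda>t. (\<Sum>i<n. coef g i * x i t) - f t)"
        by (intro nrm_triangle_via finite_sum_mem b coef g f)
      also have "nrm (\<lambda>t. (\<Sum>i<n. coef g i * x i t) - f t) \<le>
          nrm (\<lambda>t. (\<Sum>i<n. coef g i * x i t) - g t) + nrm (\<lambda>t. g t - f t)"
        by (intro nrm_triangle_via finite_sum_mem coef g f)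
      also have "nrm (\<lambda>t. (\<Sum>i<n. b i * x i t) - (\<Sum>i<n. coef g i * x i t)) =
          nrm (\<lambda>t. \<Sum>i<n. (b i - (\<Sum>k<N. coef (u k) i)) * x i t)"
        by (simp add: cg sum_subtractf left_diff_distrib)
      finally show ?thesis using tail[of "{..<n}" N] N m[OF n] by (simp add: g_def)
    qed
    then show "\<exists>m. \<forall>n\<ge>m. norm (nrm (\<lambda>t. (\<Sum>i<n. b i * x i t) - f t) - 0) < e"
      by (auto simp: nrm_nonneg)
  qed
  then have cf: "coef f = b" by (rule coef_unique[OF f b])
  show ?thesis
  proof (rule projection_norm_least)
    fix F :: "nat set" assume "finite F"
    from tail[OF this, of 0] show "nrm (\<lambda>t. \<Sum>i\<in>F. coef f i * x i t) \<le> (\<Sum>k. projection_norm (u k))"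
      by (simp add: cf T_def)
  qed
qed

text \<open>The Banach-type theorem that unconditional convergence of all expansions is automatically uniform.
The projections are not known to be continuous beforehand, so the uniform boundedness principle does
not apply; countable subadditivity replaces continuity.\<close>
theorem projections_uniformly_bounded:
  "\<exists>K>0. \<forall>f\<in>X. \<forall>F. finite F \<longrightarrow> nrm (\<lambda>t. \<Sum>i\<in>F. coef f i * x i t) \<le> K * nrm f"
proof -
  obtain K where K: "K \<ge> 0" "\<And>f. f \<in> X \<Longrightarrow> projection_norm f \<le> K * nrm f"
    using countably_subadditive_seminorm_bounded[of projection_norm, OF projection_norm_nonneg
        projection_norm_scale projection_norm_triangle projection_norm_countably_subadditive] by blast
  have "nrm (\<lambda>t. \<Sum>i\<in>F. coef f i * x i t) \<le> (K + 1) * nrm f" if "f \<in> X" "finite F" for f F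
    using projection_norm_upper[OF that] K(2)[OF that(1)] nrm_nonneg[of f] by (simp add: distrib_right)
  then show ?thesis using K(1) by (intro exI[of _ "K + 1"]) auto
qed

end

lemma (in complete_seminormed_space) unconditional_basis_rescale:
  assumes basis: "unconditional_basis nrm X d x" and r: "\<And>i. r i \<noteq> (0::real)"
  shows "unconditional_basis nrm X d (\<lambda>i t. r i * x i t)"
proof -
  let ?y = "\<lambda>i t. r i * x i t"
  have series: "series_to nrm (?y \<circ> \<pi>) (a \<circ> \<pi>) f \<longleftrightarrow> series_to nrm (x \<circ> \<pi>) ((\<lambda>i. a i * r i) \<circ> \<pi>) f" for a f \<pi>
    by (simp add: series_to_def mult.assoc)
  have series_id: "series_to nrm ?y a f \<longleftrightarrow> series_to nrm x (\<lambda>i. a i * r i) f" for a f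
    using series[of id] by simp
  have seq: "coeff_seq d (\<lambda>i. a i * r i) \<longleftrightarrow> coeff_seq d a" for a
    using r by (simp add: coeff_seq_def)
  have "\<exists>!a. coeff_seq d a \<and> series_to nrm ?y a f" if f: "f \<in> X" for f
  proof -
    obtain a where a: "coeff_seq d a" "series_to nrm x a f"
      and uniq: "\<And>b. coeff_seq d b \<Longrightarrow> series_to nrm x b f \<Longrightarrow> b = a"
      using basis f unfolding unconditional_basis_def schauder_basis_def by metis
    have rescaled: "(\<lambda>i. a i / r i * r i) = a" using r by simp
    show ?thesis
    proof (rule ex1I[of _ "\<lambda>i. a i / r i"])
      show "coeff_seq d (\<lambda>i. a i / r i) \<and> series_to nrm ?y (\<lambda>i. a i / r i) f"
        using a seq[of "\<lambda>i. a i / r i"] unfolding series_id rescaled by simp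
      fix b assume b: "coeff_seq d b \<and> series_to nrm ?y b f"
      then have "(\<lambda>i. b i * r i) = a" using uniq seq series_id by blast
      then have "b i * r i = a i" for i by (rule fun_cong)
      then show "b = (\<lambda>i. a i / r i)" using r by (simp add: fun_eq_iff nonzero_eq_divide_eq)
    qed
  qed
  moreover have "?y i \<in> X" if "enat i < d" for i
    using basis that scale_mem unfolding unconditional_basis_def schauder_basis_def by blast
  ultimately have schauder: "schauder_basis nrm X d ?y"
    unfolding schauder_basis_def by blast
  have "\<exists>g\<in>X. series_to nrm (?y \<circ> \<pi>) (a \<circ> \<pi>) g"
    if "f \<in> X" "coeff_seq d a" "series_to nrm ?y a f" "bij \<pi>" for f a \<pi>
    using basis that seq[of a] unfolding series series_id unconditional_basis_def by blast
  then show ?thesis using schauder unfolding unconditional_basis_def by blast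
qed

section \<open>Khintchine's inequality and the square function\<close>

lemma fact_double_ge: "2 ^ n * fact n \<le> (fact (2 * n) :: real)"
proof (induction n)
  case (Suc n)
  have double: "fact (2 * Suc n) = (2 * real n + 2) * ((2 * real n + 1) * fact (2 * n))"
  proof -
    have "2 * Suc n = Suc (Suc (2 * n))" by simp
    then show ?thesis by (simp only: fact_Suc of_nat_Suc of_nat_mult of_nat_numeral) (simp add: add_ac)
  qed
  have "2 ^ Suc n * fact (Suc n) = (2 * real n + 2) * (2 ^ n * fact n :: real)"
    by (simp add: algebra_simps)
  also have "\<dots> \<le> (2 * real n + 2) * fact (2 * n)" by (rule mult_left_mono[OF Suc]) simp
  also have "\<dots> \<le> (2 * real n + 2) * ((2 * real n + 1) * fact (2 * n))"
    by (rule mult_left_mono) (simp_all add: distrib_right)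
  finally show ?case unfolding double .
qed simp

text \<open>Compare power series term by term: \<open>2 ^ n * n! \<le> (2 * n)!\<close>.\<close>
lemma cosh_le_exp_square: "cosh x \<le> exp (x\<^sup>2 / 2)" for x :: real
proof -
  define c where "c n = (if even n then x ^ n /\<^sub>R fact n else 0)" for n
  have "c sums cosh x" unfolding c_def by (rule cosh_converges)
  moreover have "strict_mono (\<lambda>n::nat. 2 * n)" by (simp add: strict_mono_def)
  moreover have "c n = 0" if "n \<notin> range (\<lambda>n. 2 * n)" for n
    using that unfolding c_def by (auto simp: dvd_def)
  ultimately have "(\<lambda>n. c (2 * n)) sums cosh x"
    using sums_mono_reindex[of "\<lambda>n. 2 * n" c "cosh x"] by blast
  then have cosh: "(\<lambda>n. x ^ (2 * n) / fact (2 * n)) sums cosh x"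
    unfolding c_def by (simp add: divide_inverse mult.commute)
  have ex: "(\<lambda>n. (x\<^sup>2 / 2) ^ n / fact n) sums exp (x\<^sup>2 / 2)"
    using exp_converges[of "x\<^sup>2 / 2"] by (simp only: real_scaleR_def divide_inverse_commute)
  have "x ^ (2 * n) / fact (2 * n) \<le> (x\<^sup>2 / 2) ^ n / fact n" for n
  proof -
    have "x ^ (2 * n) / fact (2 * n) \<le> x ^ (2 * n) / (2 ^ n * fact n)"
      by (intro divide_left_mono fact_double_ge) auto
    also have "\<dots> = (x\<^sup>2 / 2) ^ n / fact n" by (simp only: power_mult power_divide divide_divide_eq_left)
    finally show ?thesis .
  qed
  then show ?thesis by (rule sums_le[OF _ cosh ex])
qed
text \<open>The Rademacher sum of \<open>c\<close> over \<open>F\<close> for the choice of signs that is \<open>+1\<close> on \<open>A\<close> and \<open>-1\<close> on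
the rest of \<open>F\<close>. Averages over independent signs become averages over \<open>Pow F\<close>.\<close>
definition signed_sum :: "'i set \<Rightarrow> 'i set \<Rightarrow> ('i \<Rightarrow> real) \<Rightarrow> real" where
  "signed_sum F A c = sum c A - sum c (F - A)"

lemma sum_Pow_insert:
  assumes "finite F" "i \<notin> F"
  shows "(\<Sum>A\<in>Pow (insert i F). \<phi> A) = (\<Sum>A\<in>Pow F. \<phi> A + \<phi> (insert i A))"
proof -
  have "(\<Sum>A\<in>Pow (insert i F). \<phi> A) = (\<Sum>A\<in>Pow F. \<phi> A) + (\<Sum>A\<in>insert i ` Pow F. \<phi> A)"
    unfolding Pow_insert using assms by (intro sum.union_disjoint) auto
  also have "(\<Sum>A\<in>insert i ` Pow F. \<phi> A) = (\<Sum>A\<in>Pow F. \<phi> (insert i A))"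
    using assms by (subst sum.reindex) (auto simp: inj_on_def)
  finally show ?thesis by (simp add: sum.distrib)
qed

lemma signed_sum_insert:
  assumes "finite F" "i \<notin> F" "A \<in> Pow F"
  shows "signed_sum (insert i F) A c = signed_sum F A c - c i"
    and "signed_sum (insert i F) (insert i A) c = signed_sum F A c + c i"
proof -
  have "insert i F - A = insert i (F - A)" "i \<notin> F - A" "finite (F - A)" "i \<notin> A" "finite A"
    "insert i F - insert i A = F - A"
    using assms by (auto intro: finite_subset)
  then show "signed_sum (insert i F) A c = signed_sum F A c - c i"
    "signed_sum (insert i F) (insert i A) c = signed_sum F A c + c i"
    by (simp_all add: signed_sum_def)
qed

lemma sum_signed_sum_squared:
  assumes "finite F"
  shows "(\<Sum>A\<in>Pow F. (signed_sum F A c)\<^sup>2) = 2 ^ card F * (\<Sum>i\<in>F. (c i)\<^sup>2)"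
  using assms
proof (induction F)
  case (insert i F)
  have "(\<Sum>A\<in>Pow (insert i F). (signed_sum (insert i F) A c)\<^sup>2)
      = (\<Sum>A\<in>Pow F. 2 * (signed_sum F A c)\<^sup>2 + 2 * (c i)\<^sup>2)"
    unfolding sum_Pow_insert[OF insert(1,2)]
    by (intro sum.cong refl)
      (simp add: signed_sum_insert[OF insert(1,2)] power2_eq_square algebra_simps)
  also have "\<dots> = 2 ^ card (insert i F) * (\<Sum>i\<in>insert i F. (c i)\<^sup>2)"
    using insert by (simp add: sum.distrib sum_distrib_left[symmetric] card_Pow algebra_simps)
  finally show ?case .
qed (simp add: signed_sum_def)

text \<open>Independence of the signs: the exponential moment factorizes.\<close>
lemma sum_exp_signed_sum:
  assumes "finite F"
  shows "(\<Sum>A\<in>Pow F. exp (signed_sum F A c)) = (\<Prod>i\<in>F. 2 * cosh (c i))"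
  using assms
proof (induction F)
  case (insert i F)
  have "(\<Sum>A\<in>Pow (insert i F). exp (signed_sum (insert i F) A c))
      = (\<Sum>A\<in>Pow F. exp (signed_sum F A c) * (2 * cosh (c i)))"
    unfolding sum_Pow_insert[OF insert(1,2)]
    by (intro sum.cong refl)
      (simp add: signed_sum_insert[OF insert(1,2)] cosh_field_def exp_add exp_diff exp_minus field_simps)
  also have "\<dots> = (\<Prod>i\<in>insert i F. 2 * cosh (c i))"
    using insert by (simp add: sum_distrib_right[symmetric] mult.commute)
  finally show ?case .
qed (simp add: signed_sum_def)

lemma sum_exp_signed_sum_le:
  assumes "finite F" "(\<Sum>i\<in>F. (c i)\<^sup>2) \<le> 1"
  shows "(\<Sum>A\<in>Pow F. exp (signed_sum F A c)) \<le> 2 ^ card F * exp 1"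
proof -
  have "(\<Prod>i\<in>F. 2 * cosh (c i)) \<le> (\<Prod>i\<in>F. 2 * exp ((c i)\<^sup>2 / 2))"
    by (intro prod_mono) (use cosh_le_exp_square cosh_real_nonneg in auto)
  also have "\<dots> = 2 ^ card F * exp (\<Sum>i\<in>F. (c i)\<^sup>2 / 2)"
    using assms(1) by (simp add: prod.distrib exp_sum)
  also have "(\<Sum>i\<in>F. (c i)\<^sup>2 / 2) \<le> 1" 
    using assms(2) sum_nonneg[of F "\<lambda>i. (c i)\<^sup>2"] by (simp add: sum_divide_distrib[symmetric])
  finally show ?thesis unfolding sum_exp_signed_sum[OF assms(1)] by simp
qed

text \<open>For coefficients of square sum \<open>1\<close> the exponential moments of a Rademacher sum are at most
\<open>exp 1\<close> on average, and \<open>\<bar>y\<bar> powr p \<le> p powr p * exp \<bar>y\<bar>\<close> turns them into a bound for the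
\<open>p\<close>-th moment. The general case follows by homogeneity.\<close>
lemma Khintchine_upper:
  assumes F: "finite F" and p: "0 < p"
  shows "(\<Sum>A\<in>Pow F. \<bar>signed_sum F A c\<bar> powr p)
    \<le> 2 ^ card F * (2 * exp 1 * p powr p * (\<Sum>i\<in>F. (c i)\<^sup>2) powr (p / 2))"
proof (cases "(\<Sum>i\<in>F. (c i)\<^sup>2) = 0")
  case True
  then have "c i = 0" if "i \<in> F" for i using F that by (simp add: sum_nonneg_eq_0_iff)
  then have "signed_sum F A c = 0" if "A \<in> Pow F" for A
    using that by (auto simp: signed_sum_def subset_iff)
  then show ?thesis by (simp add: sum_nonneg)
next
  case False
  define s where "s = sqrt (\<Sum>i\<in>F. (c i)\<^sup>2)"
  have s: "s > 0" using False by (simp add: s_def sum_nonneg less_le)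
  have s2: "s\<^sup>2 = (\<Sum>i\<in>F. (c i)\<^sup>2)" by (simp add: s_def sum_nonneg)
  have unit: "(\<Sum>i\<in>F. (c i / s)\<^sup>2) = 1" "(\<Sum>i\<in>F. (- c i / s)\<^sup>2) = 1"
    using s by (simp_all add: power_divide sum_divide_distrib[symmetric] s2[symmetric])
  have scale: "signed_sum F A (\<lambda>i. c i / s) = signed_sum F A c / s"
    "signed_sum F A (\<lambda>i. - c i / s) = - (signed_sum F A c / s)" for A
    by (simp_all add: signed_sum_def sum_divide_distrib[symmetric] sum_negf diff_divide_distrib)
  have elementary: "\<bar>y\<bar> powr p \<le> p powr p * (exp y + exp (- y))" for y :: real
  proof -
    have "\<bar>y\<bar> / p \<le> exp (\<bar>y\<bar> / p)" using exp_ge_add_one_self[of "\<bar>y\<bar> / p"] by linarith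
    then have "(\<bar>y\<bar> / p) powr p \<le> exp (\<bar>y\<bar> / p) powr p" using p by (intro powr_mono2) auto
    also have "\<dots> = exp \<bar>y\<bar>" using p by (simp add: powr_def)
    finally have "\<bar>y\<bar> powr p \<le> p powr p * exp \<bar>y\<bar>" using p by (simp add: powr_divide field_simps)
    also have "\<dots> \<le> p powr p * (exp y + exp (- y))"
      by (intro mult_left_mono) (auto simp: abs_if)
    finally show ?thesis .
  qed
  have "\<bar>signed_sum F A c\<bar> powr p \<le> s powr p * (p powr p *
      (exp (signed_sum F A (\<lambda>i. c i / s)) + exp (signed_sum F A (\<lambda>i. - c i / s))))" for A
  proof -
    have "\<bar>signed_sum F A c\<bar> powr p = s powr p * \<bar>signed_sum F A c / s\<bar> powr p"
      using s by (simp add: powr_divide)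
    also have "\<dots> \<le> s powr p * (p powr p * (exp (signed_sum F A c / s) + exp (- (signed_sum F A c / s))))"
      by (intro mult_left_mono elementary) simp
    finally show ?thesis unfolding scale .
  qed
  then have "(\<Sum>A\<in>Pow F. \<bar>signed_sum F A c\<bar> powr p) \<le> (\<Sum>A\<in>Pow F. s powr p * (p powr p *
      (exp (signed_sum F A (\<lambda>i. c i / s)) + exp (signed_sum F A (\<lambda>i. - c i / s)))))"
    by (rule sum_mono)
  also have "\<dots> = s powr p * (p powr p * ((\<Sum>A\<in>Pow F. exp (signed_sum F A (\<lambda>i. c i / s)))
      + (\<Sum>A\<in>Pow F. exp (signed_sum F A (\<lambda>i. - c i / s)))))"
    by (simp add: sum_distrib_left[symmetric] sum.distrib)
  also have "\<dots> \<le> s powr p * (p powr p * (2 ^ card F * exp 1 + 2 ^ card F * exp 1))"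
    using unit by (intro mult_left_mono add_mono sum_exp_signed_sum_le F) auto
  also have "s powr p = (\<Sum>i\<in>F. (c i)\<^sup>2) powr (p / 2)"
    unfolding s_def by (subst powr_half_sqrt[symmetric]) (simp_all add: sum_nonneg powr_powr)
  finally show ?thesis by (simp add: algebra_simps)
qed

text \<open>Bernoulli's inequality: the graph lies above its tangent at \<open>1\<close>.\<close>
lemma powr_tangent_le:
  fixes y :: real
  assumes "1 \<le> q" "0 \<le> y"
  shows "1 + q * (y - 1) \<le> y powr q"
proof (cases "y = 0")
  case False
  then have y: "y > 0" using assms by simp
  have "((\<lambda>x. x powr q) has_real_derivative q) (at 1 within {0<..})"
    by (auto intro!: derivative_eq_intros)
  then have "q * (y - 1) \<le> y powr q - 1 powr q"
    by (intro convex_on_imp_above_tangent[OF powr_convex[OF assms(1)]])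
      (use y in \<open>auto simp: interior_open\<close>)
  then show ?thesis by simp
qed (use assms in auto)

lemma square_powr_half: "(y\<^sup>2) powr (p / 2) = \<bar>y\<bar> powr p" for y :: real
proof -
  have "(y\<^sup>2) powr (p / 2) = (\<bar>y\<bar> powr 2) powr (p / 2)" by simp
  also have "\<dots> = \<bar>y\<bar> powr p" unfolding powr_powr by simp
  finally show ?thesis .
qed

text \<open>Jensen's inequality, since the average of the squares of the signed sums is the square sum.\<close>
lemma Khintchine_lower:
  assumes F: "finite F" and p: "2 \<le> p"
  shows "2 ^ card F * (\<Sum>i\<in>F. (c i)\<^sup>2) powr (p / 2) \<le> (\<Sum>A\<in>Pow F. \<bar>signed_sum F A c\<bar> powr p)"
proof (cases "(\<Sum>i\<in>F. (c i)\<^sup>2) = 0")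
  case True
  then show ?thesis by (simp add: sum_nonneg)
next
  case False
  define m where "m = (\<Sum>i\<in>F. (c i)\<^sup>2)"
  have m: "m > 0" using False by (simp add: m_def sum_nonneg less_le)
  define y where "y A = (signed_sum F A c)\<^sup>2 / m" for A
  have y_nonneg: "0 \<le> y A" for A using m by (simp add: y_def)
  have avg: "(\<Sum>A\<in>Pow F. y A) = 2 ^ card F"
    using m sum_signed_sum_squared[OF F, of c]
    by (simp add: y_def sum_divide_distrib[symmetric] m_def)
  have "(\<Sum>A\<in>Pow F. y A - 1) = 0" using F by (simp add: sum_subtractf avg card_Pow)
  then have "(\<Sum>A\<in>Pow F. 1 + (p / 2) * (y A - 1)) = 2 ^ card F"
    unfolding sum.distrib sum_distrib_left[symmetric] using F by (simp add: card_Pow)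
  then have "2 ^ card F * m powr (p / 2) = m powr (p / 2) * (\<Sum>A\<in>Pow F. 1 + (p / 2) * (y A - 1))"
    by simp
  also have "\<dots> \<le> m powr (p / 2) * (\<Sum>A\<in>Pow F. y A powr (p / 2))"
    using p m by (intro mult_left_mono sum_mono powr_tangent_le) (auto simp: y_nonneg)
  also have "\<dots> = (\<Sum>A\<in>Pow F. (m * y A) powr (p / 2))"
    using m y_nonneg by (simp add: powr_mult sum_distrib_left)
  also have "\<dots> = (\<Sum>A\<in>Pow F. \<bar>signed_sum F A c\<bar> powr p)"
    using m by (simp add: y_def square_powr_half)
  finally show ?thesis by (simp add: m_def)
qed

lemma Lp_space_signed_sum:
  assumes p: "1 \<le> p" and u: "\<And>i. i \<in> F \<Longrightarrow> u i \<in> Lp_space M p" and A: "A \<subseteq> F"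
  shows "(\<lambda>t. signed_sum F A (\<lambda>i. u i t)) \<in> Lp_space M p"
proof -
  have "(\<lambda>t. \<Sum>i\<in>A. u i t) \<in> Lp_space M p" "(\<lambda>t. \<Sum>i\<in>F - A. u i t) \<in> Lp_space M p"
    using Lp_space_sum_Minkowski[OF p, of A u M] Lp_space_sum_Minkowski[OF p, of "F - A" u M] u A by blast+
  then show ?thesis
    using Lp_space_add[OF p, of _ M "\<lambda>t. (-1) * (\<Sum>i\<in>F - A. u i t)"] Lp_space_scale[of _ M p "-1"]
    unfolding signed_sum_def by fastforce
qed

lemma square_function_integrable:
  assumes p: "2 \<le> p" and F: "finite F" and u: "\<And>i. i \<in> F \<Longrightarrow> u i \<in> Lp_space M p"
  shows "integrable M (\<lambda>t. (\<Sum>i\<in>F. (u i t)\<^sup>2) powr (p / 2))"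
proof (rule Bochner_Integration.integrable_bound)
  show "integrable M (\<lambda>t. \<Sum>A\<in>Pow F. \<bar>signed_sum F A (\<lambda>i. u i t)\<bar> powr p)"
    using p u by (intro Bochner_Integration.integrable_sum Lp_space_integrable Lp_space_signed_sum) auto
  have "(\<lambda>t. \<Sum>i\<in>F. (u i t)\<^sup>2) \<in> borel_measurable M"
    using u by (intro borel_measurable_sum borel_measurable_power Lp_space_measurable)
  then show "(\<lambda>t. (\<Sum>i\<in>F. (u i t)\<^sup>2) powr (p / 2)) \<in> borel_measurable M" by measurable
  have "(\<Sum>i\<in>F. (u i t)\<^sup>2) powr (p / 2) \<le> (\<Sum>A\<in>Pow F. \<bar>signed_sum F A (\<lambda>i. u i t)\<bar> powr p)" for t
  proof -
    have "1 * (\<Sum>i\<in>F. (u i t)\<^sup>2) powr (p / 2) \<le> 2 ^ card F * (\<Sum>i\<in>F. (u i t)\<^sup>2) powr (p / 2)"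
      by (intro mult_right_mono) auto
    then show ?thesis using Khintchine_lower[OF F p, of "\<lambda>i. u i t"] by linarith
  qed
  then show "AE t in M. norm ((\<Sum>i\<in>F. (u i t)\<^sup>2) powr (p / 2)) \<le>
      norm (\<Sum>A\<in>Pow F. \<bar>signed_sum F A (\<lambda>i. u i t)\<bar> powr p)"
    by (auto intro: order_trans[OF _ abs_ge_self])
qed

text \<open>Integrating the pointwise Khintchine inequality compares the square function with the average of
the signed sums over all signs; bounds that are uniform in the signs therefore pass to it.\<close>
lemma square_function_le_of_signed_sums:
  assumes p: "2 \<le> p" and F: "finite F" and u: "\<And>i. i \<in> F \<Longrightarrow> u i \<in> Lp_space M p"
    and c: "\<And>A. A \<subseteq> F \<Longrightarrow> Lp_norm M p (\<lambda>t. signed_sum F A (\<lambda>i. u i t)) \<le> c"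
  shows "(\<integral>t. (\<Sum>i\<in>F. (u i t)\<^sup>2) powr (p / 2) \<partial>M) \<le> c powr p"
proof -
  have c0: "0 \<le> c" using c[of "{}"] Lp_norm_nonneg order_trans by blast
  have int: "integrable M (\<lambda>t. \<bar>signed_sum F A (\<lambda>i. u i t)\<bar> powr p)" if "A \<in> Pow F" for A
    using p u that by (intro Lp_space_integrable Lp_space_signed_sum) auto
  have "2 ^ card F * (\<integral>t. (\<Sum>i\<in>F. (u i t)\<^sup>2) powr (p / 2) \<partial>M)
      = (\<integral>t. 2 ^ card F * (\<Sum>i\<in>F. (u i t)\<^sup>2) powr (p / 2) \<partial>M)" by simp
  also have "\<dots> \<le> (\<integral>t. (\<Sum>A\<in>Pow F. \<bar>signed_sum F A (\<lambda>i. u i t)\<bar> powr p) \<partial>M)"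
    by (intro integral_mono integrable_mult_right square_function_integrable p F u
        Bochner_Integration.integrable_sum int Khintchine_lower)
  also have "\<dots> = (\<Sum>A\<in>Pow F. \<integral>t. \<bar>signed_sum F A (\<lambda>i. u i t)\<bar> powr p \<partial>M)"
    by (intro Bochner_Integration.integral_sum int)
  also have "\<dots> \<le> (\<Sum>A\<in>Pow F. c powr p)"
    using c p c0 by (intro sum_mono) (simp add: Lp_norm_le_iff[symmetric])
  also have "\<dots> = 2 ^ card F * c powr p" using F by (simp add: card_Pow)
  finally show ?thesis by simp
qed

lemma square_function_ge_of_signed_sums:
  assumes p: "2 \<le> p" and F: "finite F" and u: "\<And>i. i \<in> F \<Longrightarrow> u i \<in> Lp_space M p"
    and c: "\<And>A. A \<subseteq> F \<Longrightarrow> c \<le> Lp_norm M p (\<lambda>t. signed_sum F A (\<lambda>i. u i t))" and c0: "0 \<le> c"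
  shows "c powr p \<le> 2 * exp 1 * p powr p * (\<integral>t. (\<Sum>i\<in>F. (u i t)\<^sup>2) powr (p / 2) \<partial>M)"
proof -
  have int: "integrable M (\<lambda>t. \<bar>signed_sum F A (\<lambda>i. u i t)\<bar> powr p)" if "A \<in> Pow F" for A
    using p u that by (intro Lp_space_integrable Lp_space_signed_sum) auto
  have "2 ^ card F * c powr p = (\<Sum>A\<in>Pow F. c powr p)" using F by (simp add: card_Pow)
  also have "\<dots> \<le> (\<Sum>A\<in>Pow F. Lp_norm M p (\<lambda>t. signed_sum F A (\<lambda>i. u i t)) powr p)"
    using c p c0 by (intro sum_mono powr_mono2) auto
  also have "\<dots> = (\<integral>t. (\<Sum>A\<in>Pow F. \<bar>signed_sum F A (\<lambda>i. u i t)\<bar> powr p) \<partial>M)"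
    using p Bochner_Integration.integral_sum[of "Pow F" M, OF int] by (simp add: Lp_norm_powr)
  also have "\<dots> \<le> (\<integral>t. 2 ^ card F * (2 * exp 1 * p powr p * (\<Sum>i\<in>F. (u i t)\<^sup>2) powr (p / 2)) \<partial>M)"
    using p by (intro integral_mono integrable_mult_right square_function_integrable F u
        Bochner_Integration.integrable_sum int Khintchine_upper) auto
  also have "\<dots> = 2 ^ card F * (2 * exp 1 * p powr p * (\<integral>t. (\<Sum>i\<in>F. (u i t)\<^sup>2) powr (p / 2) \<partial>M))"
    by simp
  finally show ?thesis by simp
qed

lemma signed_sum_eq_sum:
  assumes "finite F" "A \<subseteq> F"
  shows "signed_sum F A c = (\<Sum>i\<in>F. (if i \<in> A then 1 else - 1) * c i)"
proof -
  have "(\<Sum>i\<in>F. (if i \<in> A then 1 else - 1) * c i) = (\<Sum>i\<in>F. if i \<in> A then c i else - c i)"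
    by (rule sum.cong) auto
  also have "\<dots> = sum c (F \<inter> A) + (\<Sum>i\<in>F \<inter> - A. - c i)"
    using assms(1) by (simp add: sum.If_cases)
  also have "\<dots> = signed_sum F A c"
    using assms(2) by (simp add: signed_sum_def sum_negf Diff_eq Int_absorb1)
  finally show ?thesis by simp
qed

lemma (in unconditional_expansion) signs_bounded:
  assumes K: "\<And>f F. f \<in> X \<Longrightarrow> finite F \<Longrightarrow> nrm (\<lambda>t. \<Sum>i\<in>F. coef f i * x i t) \<le> K * nrm f"
    and f: "f \<in> X" and F: "finite F" "A \<subseteq> F"
  shows "nrm (\<lambda>t. signed_sum F A (\<lambda>i. coef f i * x i t)) \<le> 2 * K * nrm f"
proof -
  have "finite A" using F finite_subset by blast
  have "nrm (\<lambda>t. signed_sum F A (\<lambda>i. coef f i * x i t)) \<le>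
      nrm (\<lambda>t. \<Sum>i\<in>A. coef f i * x i t) + nrm (\<lambda>t. \<Sum>i\<in>F - A. coef f i * x i t)"
    unfolding signed_sum_def by (intro nrm_triangle_diff finite_sum_mem coef f)
  also have "\<dots> \<le> K * nrm f + K * nrm f"
    using F \<open>finite A\<close> by (intro add_mono K f) auto
  finally show ?thesis by simp
qed

text \<open>Changing the signs twice restores the original sum, so the upper estimate applies to the sum with
changed signs.\<close>
lemma (in unconditional_expansion) signs_bounded_below:
  assumes K: "\<And>f F. f \<in> X \<Longrightarrow> finite F \<Longrightarrow> nrm (\<lambda>t. \<Sum>i\<in>F. coef f i * x i t) \<le> K * nrm f"
    and f: "f \<in> X" and F: "finite F" "A \<subseteq> F"
  shows "nrm (\<lambda>t. \<Sum>i\<in>F. coef f i * x i t) \<le> 2 * K * nrm (\<lambda>t. signed_sum F A (\<lambda>i. coef f i * x i t))"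
proof -
  define e where "e i = (if i \<in> F then (if i \<in> A then 1 else - 1) * coef f i else 0)" for i
  define g where "g = (\<lambda>t. \<Sum>i\<in>F. e i * x i t)"
  have e: "coeff_seq d e" using coef(1)[OF f] by (simp add: coeff_seq_def e_def)
  have g: "g \<in> X" unfolding g_def by (rule finite_sum_mem[OF e])
  have cg: "coef g = e" unfolding g_def by (rule coef_finite_sum[OF F(1) e]) (simp add: e_def)
  have "(\<lambda>t. signed_sum F A (\<lambda>i. coef f i * x i t)) = g"
    unfolding g_def signed_sum_eq_sum[OF F] by (intro ext sum.cong) (simp_all add: e_def)
  moreover have "(\<lambda>t. signed_sum F A (\<lambda>i. coef g i * x i t)) = (\<lambda>t. \<Sum>i\<in>F. coef f i * x i t)"
    unfolding cg signed_sum_eq_sum[OF F] by (intro ext sum.cong) (simp_all add: e_def)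
  ultimately show ?thesis using signs_bounded[OF K g F] by simp
qed

section \<open>Weights from duality\<close>

text \<open>This replaces Hoelder's inequality between \<open>B\<close> in \<open>L\<^sub>q\<close> and the dual test function
\<open>h powr (q - 1) + 1\<close>: at every point the product \<open>b * h powr (q - 1)\<close> is at most the larger of
\<open>b powr q\<close> and \<open>h powr q\<close>, and \<open>b \<le> b powr q + 1\<close>. The summand \<open>1\<close> makes the test function
strictly positive.\<close>
lemma dual_test_function_bound:
  fixes B h :: "'s \<Rightarrow> real"
  assumes M: "emeasure M (space M) = 1" and q: "1 < q"
    and h: "h \<in> borel_measurable M" "\<And>t. 0 \<le> h t"
      "integrable M (\<lambda>t. h t powr q)" "(\<integral>t. h t powr q \<partial>M) \<le> 1"
    and B: "B \<in> borel_measurable M" "\<And>t. 0 \<le> B t" "integrable M (\<lambda>t. B t powr q)"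
  shows "integrable M (\<lambda>t. B t * (h t powr (q - 1) + 1))"
    and "0 < l \<Longrightarrow> (\<integral>t. B t powr q \<partial>M) \<le> l powr q \<Longrightarrow>
      (\<integral>t. B t * (h t powr (q - 1) + 1) \<partial>M) \<le> 4 * l"
proof -
  interpret finite_measure M by (rule finite_measureI) (simp add: M)
  have M1: "measure M (space M) = 1" using M by (simp add: measure_def)
  have split: "b * h t powr (q - 1) \<le> b powr q + h t powr q" if "0 \<le> b" for b t
  proof -
    let ?m = "max b (h t)"
    have "b * h t powr (q - 1) \<le> ?m * ?m powr (q - 1)"
      using q h(2)[of t] that by (intro mult_mono powr_mono2) auto
    also have "\<dots> = ?m powr q"
      using powr_add[of ?m 1 "q - 1"] that by simp
    also have "\<dots> \<le> b powr q + h t powr q" by (simp add: max_def)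
    finally show ?thesis .
  qed
  have one: "b \<le> b powr q + 1" if "0 \<le> b" for b :: real
  proof (cases "b \<le> 1")
    case False
    then have "b powr 1 \<le> b powr q" using q by (intro powr_mono) auto
    then show ?thesis using False by simp
  qed (use that in \<open>simp add: add_increasing\<close>)
  have pointwise: "B t * (h t powr (q - 1) + 1) \<le> l * (2 * (B t powr q / l powr q) + h t powr q + 1)"
    if "0 < l" for l t
  proof -
    have b: "0 \<le> B t / l" using B(2)[of t] that by simp
    have "B t * (h t powr (q - 1) + 1) = l * (B t / l * h t powr (q - 1) + B t / l)"
      using that by (simp add: field_simps)
    also have "\<dots> \<le> l * (((B t / l) powr q + h t powr q) + ((B t / l) powr q + 1))"
      using that by (intro mult_left_mono add_mono split one b) auto
    finally show ?thesis using that B(2)[of t] by (simp add: powr_divide add_ac)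
  qed
  have int_bound: "integrable M (\<lambda>t. l * (2 * (B t powr q / l powr q) + h t powr q + 1))" for l
    using B(3) h(3) by simp
  have [measurable]: "h \<in> borel_measurable M" "B \<in> borel_measurable M" using h B by auto
  show int: "integrable M (\<lambda>t. B t * (h t powr (q - 1) + 1))"
  proof (rule Bochner_Integration.integrable_bound[OF int_bound[of 1]])
    show "AE t in M. norm (B t * (h t powr (q - 1) + 1)) \<le>
        norm (1 * (2 * (B t powr q / 1 powr q) + h t powr q + 1))"
    proof (rule AE_I2)
      fix t
      have "norm (B t * (h t powr (q - 1) + 1)) = B t * (h t powr (q - 1) + 1)"
        using B(2)[of t] by simp
      then show "norm (B t * (h t powr (q - 1) + 1)) \<le>
        norm (1 * (2 * (B t powr q / 1 powr q) + h t powr q + 1))"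
        using pointwise[of 1 t] by simp
    qed
  qed measurable
  show "(\<integral>t. B t * (h t powr (q - 1) + 1) \<partial>M) \<le> 4 * l"
    if l: "0 < l" "(\<integral>t. B t powr q \<partial>M) \<le> l powr q"
  proof -
    have "(\<integral>t. B t * (h t powr (q - 1) + 1) \<partial>M) \<le>
        (\<integral>t. l * (2 * (B t powr q / l powr q) + h t powr q + 1) \<partial>M)"
      by (intro integral_mono int int_bound pointwise l)
    also have "\<dots> = l * (2 * ((\<integral>t. B t powr q \<partial>M) / l powr q) + (\<integral>t. h t powr q \<partial>M) + 1)"
      using B(3) h(3) by (simp add: M1)
    also have "\<dots> \<le> l * (2 * 1 + 1 + 1)"
      using l h(4) by (intro mult_left_mono add_mono) auto
    finally show ?thesis by simp
  qed
qed

lemma partition_weight_norm_trivial: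
  assumes "0 < p"
  shows "partition_weight_norm p {UNIV} W a =
    ennpowr (\<Sum>\<^sub>\<infinity>j. ennreal ((a j)\<^sup>2 * (W j)\<^sup>2)) (1 / 2)"
  using assms by (simp add: partition_weight_norm_def ennpowr_def powr_powr)

lemma partition_weight_norm_trivial_le:
  assumes p: "0 < p" and c: "0 \<le> c" and le: "\<And>F. finite F \<Longrightarrow> (\<Sum>j\<in>F. (a j)\<^sup>2 * (W j)\<^sup>2) \<le> c\<^sup>2"
  shows "partition_weight_norm p {UNIV} W a \<le> ennreal c"
proof -
  let ?s = "\<Sum>\<^sub>\<infinity>j. ennreal ((a j)\<^sup>2 * (W j)\<^sup>2)"
  have "?s = (SUP F\<in>{F. finite F \<and> F \<subseteq> UNIV}. \<Sum>j\<in>F. ennreal ((a j)\<^sup>2 * (W j)\<^sup>2))"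
    by (rule nonneg_infsum_complete) simp
  also have "\<dots> \<le> ennreal (c\<^sup>2)"
    by (rule SUP_least) (simp add: sum_ennreal le ennreal_leI)
  finally have s: "?s \<le> ennreal (c\<^sup>2)" .
  then obtain r where r: "?s = ennreal r" "0 \<le> r" by (cases ?s) (auto simp: top_unique)
  then have "r \<le> c\<^sup>2" using s by simp
  then have "r powr (1 / 2) \<le> c" using r(2) c by (simp add: powr_half_sqrt real_le_lsqrt)
  then show ?thesis
    unfolding partition_weight_norm_trivial[OF p] r(1) using r(2) by (simp add: ennpowr_def ennreal_leI)
qed

lemma partition_weight_norm_trivial_ge:
  assumes p: "0 < p" and c: "0 \<le> c" and F: "finite F" "c\<^sup>2 \<le> (\<Sum>j\<in>F. (a j)\<^sup>2 * (W j)\<^sup>2)"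
  shows "ennreal c \<le> partition_weight_norm p {UNIV} W a"
proof -
  let ?s = "\<Sum>\<^sub>\<infinity>j. ennreal ((a j)\<^sup>2 * (W j)\<^sup>2)"
  have "ennreal (c\<^sup>2) \<le> ennreal (\<Sum>j\<in>F. (a j)\<^sup>2 * (W j)\<^sup>2)" using F by (intro ennreal_leI)
  also have "\<dots> = (\<Sum>j\<in>F. ennreal ((a j)\<^sup>2 * (W j)\<^sup>2))" by (simp add: sum_ennreal)
  also have "\<dots> \<le> (SUP F\<in>{F. finite F \<and> F \<subseteq> UNIV}. \<Sum>j\<in>F. ennreal ((a j)\<^sup>2 * (W j)\<^sup>2))"
    using F by (intro SUP_upper) auto
  also have "\<dots> = ?s" by (rule nonneg_infsum_complete[symmetric]) simp
  finally have s: "ennreal (c\<^sup>2) \<le> ?s" .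
  show ?thesis
  proof (cases "?s = \<infinity>")
    case True
    then show ?thesis unfolding partition_weight_norm_trivial[OF p] by (simp add: ennpowr_def)
  next
    case False
    then obtain r where r: "?s = ennreal r" "0 \<le> r" by (cases ?s) auto
    then have "c\<^sup>2 \<le> r" using s by simp
    then have "c \<le> r powr (1 / 2)" using r(2) c by (simp add: powr_half_sqrt real_le_rsqrt)
    then show ?thesis
      unfolding partition_weight_norm_trivial[OF p] r(1) using r(2) by (simp add: ennpowr_def ennreal_leI)
  qed
qed

text \<open>The square of the weight at \<open>i < d\<close> is the value of a positive functional on \<open>L\<^sub>q\<close>, \<open>q = p / 2\<close>,
at \<open>(x i)\<^sup>2\<close>. As \<open>h\<close> runs through the non-negative unit ball of \<open>L\<^sub>q\<close>, the function
\<open>h powr (q - 1)\<close> runs through that of the dual space. Division by \<open>4\<close> makes the weights at most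
\<open>1\<close>, and the added \<open>1\<close> makes them positive. Beyond the length of the basis all coefficients vanish,
so \<open>1\<close> is an arbitrary value in \<open>(0, 1]\<close>.\<close>
definition dual_weight :: "'s measure \<Rightarrow> real \<Rightarrow> enat \<Rightarrow> (nat \<Rightarrow> 's \<Rightarrow> real) \<Rightarrow> ('s \<Rightarrow> real) \<Rightarrow> nat \<Rightarrow> real" where
  "dual_weight M p d x h i =
    (if enat i < d then sqrt ((\<integral>t. (x i t)\<^sup>2 * (h t powr (p / 2 - 1) + 1) \<partial>M) / 4) else 1)"

definition nonneg_unit_ball :: "'s measure \<Rightarrow> real \<Rightarrow> ('s \<Rightarrow> real) set" where
  "nonneg_unit_ball M q = {h. h \<in> borel_measurable M \<and> (\<forall>t. 0 \<le> h t) \<and>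
    integrable M (\<lambda>t. h t powr q) \<and> (\<integral>t. h t powr q \<partial>M) \<le> 1}"

locale normalized_unconditional_Lp_basis = unconditional_expansion "Lp_norm M p" X d x
  for M :: "'s measure" and p :: real and X d x +
  assumes M_prob: "emeasure M (space M) = 1"
    and p_gt: "2 < p"
    and X_sub: "X \<subseteq> Lp_space M p"
    and normalized: "\<And>i. enat i < d \<Longrightarrow> Lp_norm M p (x i) = 1"
begin

lemma basis_mem: "enat i < d \<Longrightarrow> x i \<in> X"
  using basis unfolding unconditional_basis_def schauder_basis_def by blast

lemma basis_measurable: "enat i < d \<Longrightarrow> x i \<in> borel_measurable M"
  using basis_mem X_sub Lp_space_measurable by blast

lemma basis_square_integrable: "enat i < d \<Longrightarrow> integrable M (\<lambda>t. ((x i t)\<^sup>2) powr (p / 2))"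
  using basis_mem X_sub Lp_space_integrable by (fastforce simp: square_powr_half)

lemma basis_square_integral:
  assumes "enat i < d"
  shows "(\<integral>t. ((x i t)\<^sup>2) powr (p / 2) \<partial>M) = 1"
  using normalized[OF assms] Lp_norm_powr[of p M "x i"] p_gt by (simp add: square_powr_half)

lemma coef_term_Lp: "f \<in> X \<Longrightarrow> (\<lambda>t. coef f i * x i t) \<in> Lp_space M p"
  using term_mem[OF coef(1)] X_sub by blast

context
  fixes h assumes h: "h \<in> nonneg_unit_ball M (p / 2)"
begin

lemma h_props: "h \<in> borel_measurable M" "0 \<le> h t" "integrable M (\<lambda>t. h t powr (p / 2))"
  "(\<integral>t. h t powr (p / 2) \<partial>M) \<le> 1"
  using h by (auto simp: nonneg_unit_ball_def)

lemma dual_bound: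
  assumes "B \<in> borel_measurable M" "\<And>t. 0 \<le> B t" "integrable M (\<lambda>t. B t powr (p / 2))"
  shows "integrable M (\<lambda>t. B t * (h t powr (p / 2 - 1) + 1))"
    and "0 < l \<Longrightarrow> (\<integral>t. B t powr (p / 2) \<partial>M) \<le> l powr (p / 2) \<Longrightarrow>
      (\<integral>t. B t * (h t powr (p / 2 - 1) + 1) \<partial>M) \<le> 4 * l"
  using dual_test_function_bound[OF M_prob _ h_props assms] p_gt by auto

lemma weight_integrable:
  "enat i < d \<Longrightarrow> integrable M (\<lambda>t. (x i t)\<^sup>2 * (h t powr (p / 2 - 1) + 1))"
  using basis_measurable basis_square_integrable
  by (intro dual_bound(1)) (auto intro: borel_measurable_power)

lemma weight_square:
  assumes "enat i < d"
  shows "(dual_weight M p d x h i)\<^sup>2 = (\<integral>t. (x i t)\<^sup>2 * (h t powr (p / 2 - 1) + 1) \<partial>M) / 4"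
  using assms by (simp add: dual_weight_def integral_nonneg_AE)

lemma weight_le_1: "dual_weight M p d x h i \<le> 1"
proof (cases "enat i < d")
  case True
  have "(\<integral>t. (x i t)\<^sup>2 * (h t powr (p / 2 - 1) + 1) \<partial>M) \<le> 4 * 1"
    using True basis_measurable basis_square_integrable basis_square_integral
    by (intro dual_bound(2)) (auto intro: borel_measurable_power)
  then show ?thesis using True by (simp add: dual_weight_def)
qed (simp add: dual_weight_def)

lemma weight_pos: "0 < dual_weight M p d x h i"
proof (cases "enat i < d")
  case True
  let ?v = "\<integral>t. (x i t)\<^sup>2 * (h t powr (p / 2 - 1) + 1) \<partial>M"
  have "?v \<noteq> 0"
  proof
    assume "?v = 0"
    then have "AE t in M. (x i t)\<^sup>2 * (h t powr (p / 2 - 1) + 1) = 0"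
      using integral_nonneg_eq_0_iff_AE[OF weight_integrable[OF True]] by simp
    then have "AE t in M. ((x i t)\<^sup>2) powr (p / 2) = 0"
    proof eventually_elim
      case (elim t)
      have "h t powr (p / 2 - 1) + 1 \<noteq> 0" using powr_ge_zero[of "h t" "p / 2 - 1"] by linarith
      then show ?case using elim by simp
    qed
    then have "(\<integral>t. ((x i t)\<^sup>2) powr (p / 2) \<partial>M) = 0" by (rule integral_eq_zero_AE)
    then show False using basis_square_integral[OF True] by simp
  qed
  moreover have "?v \<ge> 0" by (simp add: integral_nonneg_AE)
  ultimately have "0 < ?v" by linarith
  then show ?thesis using True by (simp add: dual_weight_def)
qed (simp add: dual_weight_def)

text \<open>The square of the weighted \<open>\<ell>\<^sub>2\<close> norm is a linear functional of the squared square function,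
which is why partitions with a single block suffice.\<close>
lemma weighted_sum_eq:
  assumes f: "f \<in> X" and F: "finite F"
  shows "(\<Sum>i\<in>F. (coef f i)\<^sup>2 * (dual_weight M p d x h i)\<^sup>2) =
    (\<integral>t. (\<Sum>i\<in>F. (coef f i * x i t)\<^sup>2) * (h t powr (p / 2 - 1) + 1) \<partial>M) / 4"
proof -
  let ?g = "\<lambda>i t. (coef f i * x i t)\<^sup>2 * (h t powr (p / 2 - 1) + 1)"
  have summand: "integrable M (?g i) \<and>
      (coef f i)\<^sup>2 * (dual_weight M p d x h i)\<^sup>2 = (\<integral>t. ?g i t \<partial>M) / 4" for i
  proof (cases "enat i < d")
    case True
    then show ?thesis using weight_integrable[OF True] weight_square[OF True]
      by (simp add: power_mult_distrib mult.assoc)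
  next
    case False
    then have "coef f i = 0" using coef(1)[OF f] by (simp add: coeff_seq_def not_less)
    then show ?thesis by simp
  qed
  have "(\<integral>t. (\<Sum>i\<in>F. (coef f i * x i t)\<^sup>2) * (h t powr (p / 2 - 1) + 1) \<partial>M) = (\<Sum>i\<in>F. \<integral>t. ?g i t \<partial>M)"
    using summand by (simp only: sum_distrib_right) (intro Bochner_Integration.integral_sum, blast)
  moreover have "(\<Sum>i\<in>F. (coef f i)\<^sup>2 * (dual_weight M p d x h i)\<^sup>2) = (\<Sum>i\<in>F. (\<integral>t. ?g i t \<partial>M) / 4)"
    by (intro sum.cong refl conjunct2[OF summand])
  ultimately show ?thesis by (simp only: sum_divide_distrib)
qed

end

lemma square_sum_measurable: "f \<in> X \<Longrightarrow> (\<lambda>t. \<Sum>i\<in>F. (coef f i * x i t)\<^sup>2) \<in> borel_measurable M"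
  by (intro borel_measurable_sum borel_measurable_power Lp_space_measurable[OF coef_term_Lp])

lemma square_sum_integrable:
  "f \<in> X \<Longrightarrow> finite F \<Longrightarrow> integrable M (\<lambda>t. (\<Sum>i\<in>F. (coef f i * x i t)\<^sup>2) powr (p / 2))"
  using p_gt by (intro square_function_integrable coef_term_Lp) auto

context
  fixes K assumes K0: "0 < K"
    and K: "\<And>f F. f \<in> X \<Longrightarrow> finite F \<Longrightarrow> Lp_norm M p (\<lambda>t. \<Sum>i\<in>F. coef f i * x i t) \<le> K * Lp_norm M p f"
begin

text \<open>The square function of \<open>f\<close> is bounded in \<open>L\<^sub>p\<close> by unconditionality, and the functionals that define
the weights are uniformly bounded on \<open>L\<^sub>q\<close>. The additional \<open>\<epsilon>\<close> covers the case of norm zero.\<close>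
lemma weighted_sum_le:
  assumes h: "h \<in> nonneg_unit_ball M (p / 2)" and f: "f \<in> X" and F: "finite F"
  shows "(\<Sum>i\<in>F. (coef f i)\<^sup>2 * (dual_weight M p d x h i)\<^sup>2) \<le> (2 * K * Lp_norm M p f)\<^sup>2"
proof (rule field_le_epsilon)
  fix \<epsilon> :: real assume \<epsilon>: "0 < \<epsilon>"
  let ?c = "2 * K * Lp_norm M p f"
  have c0: "0 \<le> ?c" using K0 Lp_norm_nonneg[of M p f] by simp
  have "(\<integral>t. (\<Sum>i\<in>F. (coef f i * x i t)\<^sup>2) powr (p / 2) \<partial>M) \<le> ?c powr p"
    using p_gt by (intro square_function_le_of_signed_sums coef_term_Lp f F signs_bounded K) auto
  also have "\<dots> = (?c\<^sup>2) powr (p / 2)" using c0 by (simp add: square_powr_half)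
  also have "\<dots> \<le> (?c\<^sup>2 + \<epsilon>) powr (p / 2)" using p_gt \<epsilon> by (intro powr_mono2) auto
  finally have "(\<integral>t. (\<Sum>i\<in>F. (coef f i * x i t)\<^sup>2) * (h t powr (p / 2 - 1) + 1) \<partial>M) \<le> 4 * (?c\<^sup>2 + \<epsilon>)"
    using \<epsilon> by (intro dual_bound(2) h square_sum_measurable square_sum_integrable f F)
      (auto intro: sum_nonneg add_nonneg_pos)
  then show "(\<Sum>i\<in>F. (coef f i)\<^sup>2 * (dual_weight M p d x h i)\<^sup>2) \<le> ?c\<^sup>2 + \<epsilon>"
    by (simp add: weighted_sum_eq[OF h f F])
qed

text \<open>Choose a partial sum with at least half the norm of \<open>f\<close>. By the upper Khintchine inequality its
squared square function \<open>H\<close> is large in \<open>L\<^sub>q\<close>, and \<open>h = H / l\<close>, where \<open>l\<close> is the norm of \<open>H\<close>,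
defines a norming functional for it: the integral of \<open>H * h powr (q - 1)\<close> equals \<open>l\<close>. In the
factor \<open>8 * K\<close>, passing to the partial sum costs \<open>2\<close>, changing signs \<open>2 * K\<close>, and the
division by \<open>4\<close> in the squared weights another \<open>2\<close>.\<close>
lemma weighted_sum_ge:
  assumes f: "f \<in> X" and pos: "0 < Lp_norm M p f"
  shows "\<exists>h\<in>nonneg_unit_ball M (p / 2). \<exists>F. finite F \<and>
    (Lp_norm M p f / (8 * K * (2 * exp 1 * p powr p) powr (1 / p)))\<^sup>2
      \<le> (\<Sum>i\<in>F. (coef f i)\<^sup>2 * (dual_weight M p d x h i)\<^sup>2)"
proof -
  define D where "D = 2 * exp 1 * p powr p"
  have D: "0 < D" using p_gt by (simp add: D_def)
  obtain n where n: "Lp_norm M p (\<lambda>t. (\<Sum>i<n. coef f i * x i t) - f t) < Lp_norm M p f / 2"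
    using LIMSEQ_D[OF coef(2)[OF f, unfolded series_to_def norm_tendsto_def], of "Lp_norm M p f / 2"] pos
    by (auto simp: Lp_norm_nonneg)
  let ?F = "{..<n}"
  let ?S = "\<lambda>t. \<Sum>i<n. coef f i * x i t"
  define H where "H t = (\<Sum>i<n. (coef f i * x i t)\<^sup>2)" for t
  have H0: "0 \<le> H t" for t by (simp add: H_def sum_nonneg)
  have H_meas: "H \<in> borel_measurable M" unfolding H_def[abs_def] by (rule square_sum_measurable[OF f])
  have H_int: "integrable M (\<lambda>t. H t powr (p / 2))"
    unfolding H_def by (rule square_sum_integrable[OF f]) simp
  define \<mu> where "\<mu> = (\<integral>t. H t powr (p / 2) \<partial>M)"
  define N where "N = Lp_norm M p f / (4 * K)"
  have N: "0 < N" using pos K0 by (simp add: N_def)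
  have "Lp_norm M p f \<le> Lp_norm M p (\<lambda>t. f t - ?S t) + Lp_norm M p ?S"
    by (intro nrm_le_diff_add f finite_sum_mem coef)
  then have half: "Lp_norm M p f / 2 \<le> Lp_norm M p ?S"
    using n nrm_minus_commute[OF f finite_sum_mem[OF coef(1)[OF f]], of ?F] by linarith
  have "N powr p \<le> D * \<mu>"
    unfolding D_def \<mu>_def H_def
  proof (rule square_function_ge_of_signed_sums)
    fix A assume "A \<subseteq> ?F"
    then have "Lp_norm M p ?S \<le> 2 * K * Lp_norm M p (\<lambda>t. signed_sum ?F A (\<lambda>i. coef f i * x i t))"
      by (intro signs_bounded_below K f) auto
    then show "N \<le> Lp_norm M p (\<lambda>t. signed_sum ?F A (\<lambda>i. coef f i * x i t))"
      using half K0 by (simp add: N_def field_simps)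
  qed (use p_gt N f coef_term_Lp in auto)
  then have \<mu>: "0 < \<mu>" and N_le: "N \<le> (D * \<mu>) powr (1 / p)"
  proof -
    assume *: "N powr p \<le> D * \<mu>"
    have "0 < N powr p" using N by simp
    then have "0 < D * \<mu>" using * by linarith
    then show "0 < \<mu>" using D by (simp add: zero_less_mult_iff)
    have "(N powr p) powr (1 / p) \<le> (D * \<mu>) powr (1 / p)" using * p_gt by (intro powr_mono2) auto
    then show "N \<le> (D * \<mu>) powr (1 / p)" using N p_gt by (simp add: powr_powr)
  qed
  define l where "l = (\<mu> powr (1 / p))\<^sup>2"
  have l: "0 < l" using \<mu> by (simp add: l_def)
  have l_powr: "l powr (p / 2) = \<mu>" using \<mu> p_gt by (simp add: l_def square_powr_half powr_powr)
  define h where "h t = H t / l" for t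
  have h_powr: "h t powr (p / 2) = H t powr (p / 2) / \<mu>" for t
    using H0 l l_powr by (simp add: h_def powr_divide)
  have h_int: "(\<integral>t. h t powr (p / 2) \<partial>M) = 1" using \<mu> by (simp add: h_powr \<mu>_def)
  have h: "h \<in> nonneg_unit_ball M (p / 2)"
    unfolding nonneg_unit_ball_def
  proof (intro CollectI conjI allI)
    show "h \<in> borel_measurable M" unfolding h_def[abs_def] using H_meas by measurable
    show "integrable M (\<lambda>t. h t powr (p / 2))" using H_int by (simp add: h_powr)
  qed (use H0 l h_int in \<open>simp_all add: h_def\<close>)
  have "l = (\<integral>t. l * h t powr (p / 2) \<partial>M)" by (simp add: h_int)
  also have "\<dots> \<le> (\<integral>t. H t * (h t powr (p / 2 - 1) + 1) \<partial>M)"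
  proof (rule integral_mono)
    show "integrable M (\<lambda>t. l * h t powr (p / 2))" using H_int by (simp add: h_powr)
    show "integrable M (\<lambda>t. H t * (h t powr (p / 2 - 1) + 1))"
      by (rule dual_bound(1)[OF h H_meas H0 H_int])
    fix t
    have "l * h t powr (p / 2) = l * (h t * h t powr (p / 2 - 1))"
      using powr_mult_base[of "h t" "p / 2 - 1"] H0 l by (simp add: h_def)
    also have "\<dots> = H t * h t powr (p / 2 - 1)" using l by (simp add: h_def)
    also have "\<dots> \<le> H t * (h t powr (p / 2 - 1) + 1)" using H0 by (simp add: distrib_left)
    finally show "l * h t powr (p / 2) \<le> H t * (h t powr (p / 2 - 1) + 1)" .
  qed
  finally have "l / 4 \<le> (\<Sum>i<n. (coef f i)\<^sup>2 * (dual_weight M p d x h i)\<^sup>2)"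
    by (simp add: weighted_sum_eq[OF h f] H_def)
  moreover have "(Lp_norm M p f / (8 * K * D powr (1 / p)))\<^sup>2 \<le> l / 4"
  proof -
    have "N \<le> D powr (1 / p) * \<mu> powr (1 / p)" using N_le D \<mu> by (simp add: powr_mult)
    then have "N / (2 * D powr (1 / p)) \<le> \<mu> powr (1 / p) / 2" using D by (simp add: field_simps)
    then have "(N / (2 * D powr (1 / p)))\<^sup>2 \<le> (\<mu> powr (1 / p) / 2)\<^sup>2"
      using N by (intro power_mono) auto
    then show ?thesis by (simp add: N_def l_def power_divide power_mult_distrib)
  qed
  ultimately show ?thesis using h unfolding D_def by (meson finite_lessThan order_trans)
qed

end

theorem equivalent_partitions_weights_norm:
  "has_equivalent_partitions_weights_norm p (Lp_norm M p) X"
proof -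
  obtain K where K0: "0 < K" and K: "\<And>f F. f \<in> X \<Longrightarrow> finite F \<Longrightarrow>
      Lp_norm M p (\<lambda>t. \<Sum>i\<in>F. coef f i * x i t) \<le> K * Lp_norm M p f"
    using projections_uniformly_bounded by blast
  define c where "c = 1 / (8 * K * (2 * exp 1 * p powr p) powr (1 / p))"
  have c: "0 < c" using K0 p_gt by (simp add: c_def)
  define Fam where "Fam = (\<lambda>h. ({UNIV :: nat set}, dual_weight M p d x h)) ` nonneg_unit_ball M (p / 2)"
  have "(\<lambda>t. 0) \<in> nonneg_unit_ball M (p / 2)" using p_gt by (simp add: nonneg_unit_ball_def)
  then have fam: "partitions_weights_family Fam"
    unfolding partitions_weights_family_def Fam_def
    using weight_pos weight_le_1 by (auto simp: partition_on_def disjoint_def)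
  have bounds: "ennreal (c * Lp_norm M p f) \<le> partitions_weights_norm p Fam a \<and>
      partitions_weights_norm p Fam a \<le> ennreal ((2 * K + c) * Lp_norm M p f)"
    if f: "f \<in> X" and a: "coeff_seq d a \<and> series_to (Lp_norm M p) x a f" for f a
  proof
    have a_eq: "a = coef f" using coef_unique[OF f] a by blast
    have norm_eq: "partitions_weights_norm p Fam a =
        (SUP h\<in>nonneg_unit_ball M (p / 2). partition_weight_norm p {UNIV} (dual_weight M p d x h) (coef f))"
      by (simp add: partitions_weights_norm_def Fam_def image_image a_eq)
    show "ennreal (c * Lp_norm M p f) \<le> partitions_weights_norm p Fam a"
    proof (cases "Lp_norm M p f = 0")
      case False
      then have "0 < Lp_norm M p f" using Lp_norm_nonneg[of M p f] by simp
      from weighted_sum_ge[OF K0 K f this] obtain h F where h: "h \<in> nonneg_unit_ball M (p / 2)"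
        and F: "finite F" "(c * Lp_norm M p f)\<^sup>2 \<le> (\<Sum>i\<in>F. (coef f i)\<^sup>2 * (dual_weight M p d x h i)\<^sup>2)"
        by (auto simp: c_def)
      have "ennreal (c * Lp_norm M p f) \<le> partition_weight_norm p {UNIV} (dual_weight M p d x h) (coef f)"
        using p_gt c by (intro partition_weight_norm_trivial_ge[OF _ _ F]) (auto simp: Lp_norm_nonneg)
      also have "\<dots> \<le> partitions_weights_norm p Fam a" unfolding norm_eq by (rule SUP_upper[OF h])
      finally show ?thesis .
    qed simp
    have "partitions_weights_norm p Fam a \<le> ennreal (2 * K * Lp_norm M p f)"
      unfolding norm_eq
      using p_gt K0 by (intro SUP_least partition_weight_norm_trivial_le weighted_sum_le K0 K f)
        (auto simp: Lp_norm_nonneg)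
    also have "\<dots> \<le> ennreal ((2 * K + c) * Lp_norm M p f)"
      using c by (intro ennreal_leI mult_right_mono) (auto simp: Lp_norm_nonneg)
    finally show "partitions_weights_norm p Fam a \<le> ennreal ((2 * K + c) * Lp_norm M p f)" .
  qed
  have schauder: "schauder_basis (Lp_norm M p) X d x" using basis by (simp add: unconditional_basis_def)
  show ?thesis
    unfolding has_equivalent_partitions_weights_norm_def
    by (rule exI[of _ d], rule exI[of _ x], rule exI[of _ Fam], rule exI[of _ c], rule exI[of _ "2 * K + c"])
      (use schauder fam c K0 bounds in auto)
qed

end

section \<open>Subspaces with an unconditional basis\<close>

text \<open>Weights have to be at most \<open>1\<close>, which needs basis vectors of bounded norm; so the basis is
normalized.\<close>
theorem subspace_has_equivalent_partitions_weights_norm: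
  assumes M: "emeasure M (space M) = 1" and p: "2 < p"
    and X: "closed_linear_subspace (Lp_norm M p) (Lp_space M p) X"
    and basis: "unconditional_basis (Lp_norm M p) X d x"
  shows "has_equivalent_partitions_weights_norm p (Lp_norm M p) X"
proof -
  interpret complete_seminormed_space "Lp_norm M p" X
    using p by (intro closed_subspace_complete X) simp
  interpret U: unconditional_expansion "Lp_norm M p" X d x
    by unfold_locales (rule basis)
  define r where "r i = (if enat i < d then 1 / Lp_norm M p (x i) else 1)" for i
  have r: "r i \<noteq> 0" for i using U.nrm_basis_pos[of i] by (cases "enat i < d") (auto simp: r_def)
  have norm1: "Lp_norm M p (\<lambda>t. r i * x i t) = 1" if "enat i < d" for i
    using U.nrm_basis_pos[OF that] that p Lp_norm_scale[of p M "1 / Lp_norm M p (x i)" "x i"]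
    by (simp add: r_def)
  interpret N: normalized_unconditional_Lp_basis M p X d "\<lambda>i t. r i * x i t"
    by unfold_locales
      (use unconditional_basis_rescale[OF basis r] M p X norm1 in \<open>auto simp: closed_linear_subspace_def\<close>)
  show ?thesis by (rule N.equivalent_partitions_weights_norm)
qed

theorem theorem1p1:
  fixes p :: real and X :: "(real \<Rightarrow> real) set"
  assumes "2 < p"
    and "closed_linear_subspace (Lp_norm (lebesgue_on {0..1}) p) (Lp_space (lebesgue_on {0..1}) p) X"
    and "\<exists>d x. unconditional_basis (Lp_norm (lebesgue_on {0..1}) p) X d x"
  shows "has_equivalent_partitions_weights_norm p (Lp_norm (lebesgue_on {0..1}) p) X"
proof -
  have "emeasure (lebesgue_on {0..1}) (space (lebesgue_on {0..1::real})) = 1"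
    by (simp add: space_restrict_space emeasure_restrict_space)
  then show ?thesis
    using assms subspace_has_equivalent_partitions_weights_norm by blast
qed

end
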